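(* Let $\lambda$ be an admissible probability measure on $\mathcal X$. Let $\mathcal A_1,\dots,\mathcal A_r\subset\mathbb R^k$ be bounded Borel sets with $\mathrm{vol}_{\mathbb R^k}(\partial\mathcal A_i)=0$, let $\mathcal D_1,\dots,\mathcal D_r\subset\Sigma(\mathcal W,1)$ be Borel sets each having compact closure in $HQ$ and satisfying $\nu(\partial\mathcal D_i)=0$ (boundary taken in $HQ$), and let $N\in\mathbb Z_{\ge0}^r$. Then $$\lim_{L\to\infty}\lambda\big(\{x:\#\{j:L^{-n/k}\xi_j(x,L)\in\mathcal A_i,\ \omega_j(x,L)\in\mathcal D_i\}=N_i\ \forall i\}\big)=\Psi^{(r)}_N(\mathcal A,\mathcal D),$$ where $$\Psi^{(r)}_N(\mathcal A,\mathcal D)=\mu\big(\{x:\#\{j:\xi_j(x,1)\in\mathcal A_i,\ \omega_j(x,1)\in\mathcal D_i\}=N_i\ \forall i\}\big)=\mu\big(\{\Gamma g:\#\{\gamma\in\Gamma:\gamma g\in\mathcal D_iU(-\mathcal A_i)\}=N_i\ \forall i\}\big),$$ with $\mathcal D_iU(-\mathcal A_i)=\{dU(-a):d\in\mathcal D_i,a\in\mathcal A_i\}$.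
   Context: Fix integers $k\ge1$, $m\ge0$, $n=k+m+1$; $G=\mathrm{SL}(n,\mathbb R)$, $\Gamma=\mathrm{SL}(n,\mathbb Z)$, $\mathcal X=\Gamma\backslash G$, $\mu$ the right-$G$-invariant probability measure on $\mathcal X$. Row vectors $y=(y',y'',y_n)\in\mathbb R^k\times\mathbb R^m\times\mathbb R$, right action. $U(s)=\begin{pmatrix}1_k&0&0\\0&1_m&0\\-s&0&1\end{pmatrix}$ ($s\in\mathbb R^k$, middle block absent if $m=0$), $h_s(x)=xU(s)$; $\Phi(t)=\mathrm{diag}(e^{(m+1)t}1_k,e^{-kt}1_m,e^{-kt})$, $\varphi_t(x)=x\Phi(t)$. A Borel probability measure $\lambda$ on $\mathcal X$ is admissible if $\lim_{t\to\infty}\lambda(\varphi_tE)=\mu(E)$ for every Borel $E$ with $\mu(\partial E)=0$. Fix a norm $|\cdot|$ on $\mathbb R^k$. Let $H=\{g\in G:(0,\dots,0,1)g=(0,\dots,0,1)\}=\{\begin{pmatrix}A&{}^tb\\0&1\end{pmatrix}:A\in\mathrm{SL}(n-1,\mathbb R),b\in\mathbb R^{n-1}\}$, $\Gamma_H=\Gamma\cap H$, and fix a Borel fundamental domain $\mathcal F_H\subset H$ for the left action of $\Gamma_H$. For $w=(w',w_{m+1})\in\mathbb R^m\times\mathbb R_{>0}$ let $R(w)=\begin{pmatrix}w_{m+1}^{-(m+1)/k}1_k&0&0\\0&w_{m+1}1_m&0\\0&w'&w_{m+1}\end{pmatrix}$, $Q=\{R(w)\}$. Each $a\in HQ$ is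 uniquely $a=\begin{pmatrix}A&{}^tb\\0&1\end{pmatrix}R(w)$; the measure $\nu$ on $HQ$ is $d\nu(a)=\zeta(n)^{-1}d\mu_0(A)\,db\,w_{m+1}^kdw$, with $\mu_0$ the Haar measure on $\mathrm{SL}(n-1,\mathbb R)$ giving $\mathrm{SL}(n-1,\mathbb Z)\backslash\mathrm{SL}(n-1,\mathbb R)$ measure 1. Let $\mathcal W\subset\mathbb R^m\times\mathbb R_{>0}$ be bounded Borel with non-empty interior and Lebesgue-null boundary; $\Sigma(\mathcal W,1)=\mathcal F_H\{R(w):w\in\mathcal W\}\subset G$; for $L>0$, $\pi_L:\Sigma(\mathcal W,1)\to\mathcal X$, $\pi_L(g)=\Gamma g\Phi(k^{-1}\log L)$, whose image is the section $\mathcal H(\mathcal W,L)=\Gamma\backslash\Gamma H\{R(w):w\in L^{-1}\mathcal W\}$. Hitting times $\xi_j(x,L)\in\mathbb R^k$ are the $s$ with $h_s(x)\in\mathcal H(\mathcal W,L)$, each listed $\#\pi_L^{-1}(\{h_s(x)\})$ times, ordered with $|\xi_1|\le|\xi_2|\le\cdots$ (equivalently, for $x=\Gamma g$, the multiset $\{v'/v_n:v\in\widehat{\mathbb Z}^ng,(v'',v_n)\in L^{-1}\mathcal W\}$, $\widehat{\mathbb Z}^n$ the primitive integer vectors). Impact parameters $\omega_j(x,L)\in\pi_L^{-1}(\{h_{\xi_j(x,L)}(x)\})$ are chosen so that for each $s$, $j\mapsto\omega_j(x,L)$ is a bijection from $\{j:\xi_j(x,L)=s\}$ onto $\pi_L^{-1}(\{h_s(x)\})$.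 The ordering and impact parameters are chosen for $L=1$ and defined for general $L$ by $\xi_j(x,L)=L^{n/k}\xi_j(\varphi_{-k^{-1}\log L}(x),1)$, $\omega_j(x,L)=\omega_j(\varphi_{-k^{-1}\log L}(x),1)$. *)

theory Defs
  imports "HOL-Analysis.Analysis" "HOL-Probability.Probability"
begin

text \<open>Conventions.  The index set of coordinates of R^n is the finite type 'k + 'j:
  the indices Inl a (a :: 'k) are the first k coordinates (the block y'), and the indices
  Inr i (i :: 'j) are the last m+1 coordinates (y'', y_n), where the distinguished element
  e :: 'j is the last coordinate n.  Thus k = CARD('k) and m + 1 = CARD('j).
  Matrices act on row vectors from the right; group elements of G = SL(n,R) are n x n
  real matrices with determinant 1; products are matrix products.\<close>

type_synonym ('k, 'j) mat = "real ^ ('k + 'j) ^ ('k + 'j)"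

definition SLn :: "('k::finite, 'j::finite) mat set" where
  "SLn = {g. det g = 1}"

definition Gamma :: "('k::finite, 'j::finite) mat set" where
  "Gamma = {g. det g = 1 \<and> (\<forall>p q. g $ p $ q \<in> \<int>)}"

definition coset :: "('k::finite, 'j::finite) mat \<Rightarrow> ('k, 'j) mat set" where
  "coset g = {gam ** g | gam. gam \<in> Gamma}"

definition Xsp :: "('k::finite, 'j::finite) mat set set" where
  "Xsp = coset ` SLn"

definition Xact :: "('k::finite, 'j::finite) mat set \<Rightarrow> ('k, 'j) mat \<Rightarrow> ('k, 'j) mat set" where
  "Xact x g = (\<lambda>h. h ** g) ` x"

definition quot_top :: "'a topology \<Rightarrow> ('a \<Rightarrow> 'b) \<Rightarrow> 'b topology" where
  "quot_top T f = topology (\<lambda>U. U \<subseteq> f ` topspace T \<and> openin T {x \<in> topspace T. f x \<in> U})"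

lemma istopology_quot: "istopology (\<lambda>U. U \<subseteq> f ` topspace T \<and> openin T {x \<in> topspace T. f x \<in> U})"
proof -
  have 1: "{x \<in> topspace T. f x \<in> S \<inter> V} = {x \<in> topspace T. f x \<in> S} \<inter> {x \<in> topspace T. f x \<in> V}" for S V
    by auto
  have 2: "{x \<in> topspace T. f x \<in> \<Union>K} = (\<Union>U\<in>K. {x \<in> topspace T. f x \<in> U})" for K
    by auto
  show ?thesis unfolding istopology_def 1 2
    by (intro conjI allI impI) (auto intro!: openin_Union)
qed

lemma openin_quot_top:
  "openin (quot_top T f) U \<longleftrightarrow> U \<subseteq> f ` topspace T \<and> openin T {x \<in> topspace T. f x \<in> U}"
  unfolding quot_top_def by (simp only: topology_inverse'[OF istopology_quot])

definition Xtop :: "('k::finite, 'j::finite) mat set topology" where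
  "Xtop = quot_top (top_of_set SLn) coset"

definition Xborel :: "('k::finite, 'j::finite) mat set measure" where
  "Xborel = sigma Xsp (Collect (openin Xtop))"

definition Xbd :: "('k::finite, 'j::finite) mat set set \<Rightarrow> ('k, 'j) mat set set" where
  "Xbd E = Xtop frontier_of E"

definition Umat :: "'j \<Rightarrow> real ^ 'k \<Rightarrow> ('k::finite, 'j::finite) mat" where
  "Umat e s = (\<chi> p q. if p = q then 1 else
      (case (p, q) of (Inr i, Inl a) \<Rightarrow> if i = e then - (s $ a) else 0 | _ \<Rightarrow> 0))"

definition Phimat :: "'j \<Rightarrow> real \<Rightarrow> ('k::finite, 'j::finite) mat" where
  "Phimat e t = (\<chi> p q. if p = q then
      (case p of Inl a \<Rightarrow> exp (real CARD('j) * t) | Inr i \<Rightarrow> exp (- real CARD('k) * t)) else 0)"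

definition phi :: "'j \<Rightarrow> real \<Rightarrow> ('k::finite, 'j::finite) mat set \<Rightarrow> ('k, 'j) mat set" where
  "phi e t x = Xact x (Phimat e t)"

text \<open>R(w) for w = (w', w_{m+1}), where w_{m+1} = w $ e and w' = (w $ i)_{i \<noteq> e}.\<close>
definition Rmat :: "'j \<Rightarrow> real ^ 'j \<Rightarrow> ('k::finite, 'j::finite) mat" where
  "Rmat e w = (\<chi> p q. case (p, q) of
      (Inl a, Inl b) \<Rightarrow> if a = b then (w $ e) powr (- real CARD('j) / real CARD('k)) else 0
    | (Inr i, Inr j) \<Rightarrow> if i = e then w $ j else if i = j then w $ e else 0
    | _ \<Rightarrow> 0)"

definition Hgrp :: "'j \<Rightarrow> ('k::finite, 'j::finite) mat set" where
  "Hgrp e = {g \<in> SLn. (axis (Inr e) 1 :: real ^ ('k + 'j)) v* g = axis (Inr e) 1}"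

definition GammaH :: "'j \<Rightarrow> ('k::finite, 'j::finite) mat set" where
  "GammaH e = Gamma \<inter> Hgrp e"

definition Wpos :: "'j \<Rightarrow> (real ^ 'j) set" where
  "Wpos e = {w. w $ e > 0}"

definition HQ :: "'j \<Rightarrow> ('k::finite, 'j::finite) mat set" where
  "HQ e = {h ** Rmat e w | h w. h \<in> Hgrp e \<and> w \<in> Wpos e}"

definition fund_dom_H :: "'j \<Rightarrow> ('k::finite, 'j::finite) mat set \<Rightarrow> bool" where
  "fund_dom_H e F \<longleftrightarrow> F \<subseteq> Hgrp e \<and> F \<in> sets borel \<and>
     (\<forall>h \<in> Hgrp e. \<exists>!f \<in> F. \<exists>gam \<in> GammaH e. h = gam ** f)"

definition Sigma1 :: "'j \<Rightarrow> ('k::finite, 'j::finite) mat set \<Rightarrow> (real ^ 'j) set \<Rightarrow> ('k, 'j) mat set" where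
  "Sigma1 e F W = {f ** Rmat e w | f w. f \<in> F \<and> w \<in> W}"

text \<open>Haar measure on H (determined up to a positive scalar; only its null sets matter below):
  a Borel measure on H, left-invariant, finite on compact sets, positive on nonempty open sets.\<close>
definition haar_H :: "'j \<Rightarrow> ('k::finite, 'j::finite) mat measure \<Rightarrow> bool" where
  "haar_H e M \<longleftrightarrow> sets M = sets (restrict_space borel (Hgrp e)) \<and>
     (\<forall>h0 \<in> Hgrp e. \<forall>S \<in> sets M. emeasure M ((\<lambda>h. h0 ** h) ` S) = emeasure M S) \<and>
     (\<forall>K. compact K \<and> K \<subseteq> Hgrp e \<longrightarrow> emeasure M K < \<infinity>) \<and>
     (\<forall>U. openin (top_of_set (Hgrp e)) U \<and> U \<noteq> {} \<longrightarrow> emeasure M U > 0)"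

text \<open>nu-null subsets of HQ: d nu = zeta(n)^{-1} d mu_0(A) db w_{m+1}^k dw, and d mu_0(A) db is
  Haar measure of H, so S is nu-null iff its preimage under (h,w) \<mapsto> h R(w) is null for
  (Haar on H) x (Lebesgue on R^m x R_{>0}).\<close>
definition nu_null :: "'j \<Rightarrow> ('k::finite, 'j::finite) mat measure \<Rightarrow> ('k, 'j) mat set \<Rightarrow> bool" where
  "nu_null e M S \<longleftrightarrow>
     {(h, w). h \<in> Hgrp e \<and> w \<in> Wpos e \<and> h ** Rmat e w \<in> S} \<in> null_sets (M \<Otimes>\<^sub>M (lborel :: (real ^ 'j) measure))"

definition haar_X :: "('k::finite, 'j::finite) mat set measure \<Rightarrow> bool" where
  "haar_X mu \<longleftrightarrow> prob_space mu \<and> space mu = Xsp \<and> sets mu = sets Xborel \<and>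
     (\<forall>g \<in> SLn. \<forall>E \<in> sets mu. measure mu ((\<lambda>x. Xact x g) ` E) = measure mu E)"

definition admissible :: "'j \<Rightarrow> ('k::finite, 'j::finite) mat set measure \<Rightarrow> ('k, 'j) mat set measure \<Rightarrow> bool" where
  "admissible e mu lam \<longleftrightarrow> prob_space lam \<and> space lam = Xsp \<and> sets lam = sets Xborel \<and>
     (\<forall>E \<in> sets Xborel. measure mu (Xbd E) = 0 \<longrightarrow>
        ((\<lambda>t. measure lam (phi e t ` E)) \<longlongrightarrow> measure mu E) at_top)"

text \<open>The set of pairs (s, omega) with omega \<in> pi_1^{-1}(h_s(x)), s \<in> A, omega \<in> D,
  i.e. the pairs (xi_j(x,1), omega_j(x,1)) counted by #{j : xi_j(x,1) \<in> A, omega_j(x,1) \<in> D}.\<close>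
definition hits :: "'j \<Rightarrow> ('k::finite, 'j::finite) mat set \<Rightarrow> (real ^ 'j) set \<Rightarrow> ('k, 'j) mat set
     \<Rightarrow> (real ^ 'k) set \<Rightarrow> ('k, 'j) mat set \<Rightarrow> ((real ^ 'k) \<times> ('k, 'j) mat) set" where
  "hits e F W x A D = {(s, g). g \<in> Sigma1 e F W \<and> coset g = Xact x (Umat e s) \<and> s \<in> A \<and> g \<in> D}"

text \<open>#{j : L^{-n/k} xi_j(x,L) \<in> A, omega_j(x,L) \<in> D}
   = #{j : xi_j(phi_{-k^{-1} log L}(x),1) \<in> A, omega_j(phi_{-k^{-1} log L}(x),1) \<in> D}.\<close>
definition hits_L :: "'j \<Rightarrow> ('k::finite, 'j::finite) mat set \<Rightarrow> (real ^ 'j) set \<Rightarrow> real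
     \<Rightarrow> ('k, 'j) mat set \<Rightarrow> (real ^ 'k) set \<Rightarrow> ('k, 'j) mat set \<Rightarrow> ((real ^ 'k) \<times> ('k, 'j) mat) set" where
  "hits_L e F W L x A D = hits e F W (phi e (- ln L / real CARD('k)) x) A D"

end

theory Submission
  imports Defs
begin

text \<open>
  Let \<open>E\<close> be the set of \<open>x\<close> with the prescribed hit counts at \<open>L = 1\<close>. The event at scale \<open>L\<close> is
  the translate of \<open>E\<close> under \<open>\<phi>\<^sub>t\<close> with \<open>t = k\<^sup>-\<^sup>1 log L\<close>, so by admissibility it suffices
  that \<open>E\<close> is Borel and that its boundary is \<open>\<mu>\<close>-null.

  For \<open>x = \<Gamma>g\<close> the hits correspond to the \<open>\<gamma> \<in> \<Gamma>\<close> with \<open>\<gamma>g \<in> D\<^sub>iU(-A\<^sub>i)\<close>. As \<open>\<Gamma>\<close> is discrete and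
  these sets are relatively compact, the counts are locally constant at \<open>g\<close> unless \<open>\<Gamma>g\<close> meets
  \<open>(\<partial>D\<^sub>i)U\<close> or \<open>cl(D\<^sub>i)U(-\<partial>A\<^sub>i)\<close>.

  Both sets have null image in \<open>\<X>\<close>, by Fubini. For the second one, average over right translations by
  \<open>U(s)\<close>. For the first one, average \<open>\<mu>\<close> over right translations by matrices normalised to determinant
  one: this reduces the claim to the Lebesgue measure of a set of matrices, and averaging that set over left
  translations by \<open>H\<close> reduces it to \<open>\<nu>(\<partial>D\<^sub>i) = 0\<close>.
\<close>

section \<open>Matrices of determinant one\<close>

text \<open>A permutation other than the identity moves at least two points, hence some
  \<open>q\<close> different from \<open>e\<close>; row \<open>q\<close> is zero off the diagonal,
  so its term in the Leibniz formula vanishes. Both \<open>Umat\<close> and \<open>Rmat\<close> have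
  this shape, with \<open>Inr e\<close> as the exceptional row.\<close>

lemma det_one_row:
  fixes M :: "real ^ 'n ^ 'n"
  assumes "\<And>p q. p \<noteq> e \<Longrightarrow> q \<noteq> p \<Longrightarrow> M $ p $ q = 0"
  shows "det M = (\<Prod>p\<in>UNIV. M $ p $ p)"
proof -
  have zero: "of_int (sign \<pi>) * (\<Prod>p\<in>UNIV. M $ p $ \<pi> p) = 0"
    if \<pi>: "\<pi> permutes UNIV" "\<pi> \<noteq> id" for \<pi>
  proof -
    obtain p where p: "\<pi> p \<noteq> p"
      using \<pi>(2) by (metis eq_id_iff)
    have inj: "inj \<pi>"
      using \<pi>(1) by (rule permutes_inj)
    have "\<exists>q. q \<noteq> e \<and> \<pi> q \<noteq> q"
      using p inj by (metis injD)
    then obtain q where "M $ q $ \<pi> q = 0"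
      using assms by blast
    then show ?thesis
      by (metis (mono_tags, lifting) UNIV_I finite mult_zero_right prod_zero)
  qed
  have "det M = (\<Sum>\<pi>\<in>{id}. of_int (sign \<pi>) * (\<Prod>p\<in>UNIV. M $ p $ \<pi> p))"
    unfolding det_def
    by (rule sum.mono_neutral_right) (auto simp: zero permutes_id)
  then show ?thesis by simp
qed

lemma prod_UNIV_sum:
  fixes f :: "'a::finite + 'b::finite \<Rightarrow> real"
  shows "(\<Prod>p\<in>UNIV. f p) = (\<Prod>a\<in>UNIV. f (Inl a)) * (\<Prod>b\<in>UNIV. f (Inr b))"
  by (simp flip: UNIV_Plus_UNIV add: prod.Plus)

lemma det_Umat [simp]: "det (Umat e s :: ('k::finite,'j::finite) mat) = 1"
proof -
  have "det (Umat e s :: ('k,'j) mat) = (\<Prod>p\<in>UNIV. (Umat e s :: ('k,'j) mat) $ p $ p)"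
    by (rule det_one_row[where e = "Inr e"]) (auto simp: Umat_def split: sum.split)
  then show ?thesis by (simp add: Umat_def)
qed

lemma det_Rmat [simp]:
  assumes "w \<in> Wpos e"
  shows "det (Rmat e w :: ('k::finite,'j::finite) mat) = 1"
proof -
  have w: "w $ e > 0" using assms by (simp add: Wpos_def)
  have "det (Rmat e w :: ('k,'j) mat) = (\<Prod>p\<in>UNIV. (Rmat e w :: ('k,'j) mat) $ p $ p)"
    by (rule det_one_row[where e = "Inr e"]) (auto simp: Rmat_def split: sum.split)
  also have "\<dots> = (w $ e powr (- real CARD('j) / real CARD('k))) ^ CARD('k) * (w $ e) ^ CARD('j)"
    unfolding prod_UNIV_sum by (simp add: Rmat_def cong: if_cong)
  \<comment> \<open>The exponent \<open>-(m+1)/k\<close> in \<open>Rmat\<close> is chosen so that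
    its \<open>k\<close> copies cancel the \<open>m+1\<close> diagonal entries
    \<open>w $ e\<close>.\<close>
  also have "\<dots> = w $ e powr (- real CARD('j)) * w $ e powr real CARD('j)"
    using w by (simp add: powr_realpow[symmetric] powr_powr)
  also have "\<dots> = 1"
    using w by (simp flip: powr_add)
  finally show ?thesis .
qed

lemma det_Phimat [simp]: "det (Phimat e t :: ('k::finite,'j::finite) mat) = 1"
proof -
  have "det (Phimat e t :: ('k,'j) mat) = (\<Prod>p\<in>UNIV. (Phimat e t :: ('k,'j) mat) $ p $ p)"
    by (rule det_diagonal) (simp add: Phimat_def)
  also have "\<dots> = 1"
    unfolding prod_UNIV_sum by (simp add: Phimat_def flip: exp_of_nat_mult exp_add)
  finally show ?thesis .
qed

lemma Phimat_inverse: "Phimat e t ** Phimat e (- t) = (mat 1 :: ('k::finite,'j::finite) mat)"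
proof -
  have eq: "(Phimat e t :: ('k,'j) mat) $ p $ l * (Phimat e (- t) :: ('k,'j) mat) $ l $ q
      = (if l = p then if p = q then 1 else 0 else 0)" for p l q
    by (auto simp: Phimat_def split: sum.split simp flip: exp_add)
  show ?thesis
    by (simp add: matrix_matrix_mult_def mat_def vec_eq_iff eq)
qed

section \<open>Right multiplication by \<open>U(s)\<close> as a column operation\<close>

lemma mult_Umat:
  "(g ** Umat e s) $ p $ Inl a = g $ p $ Inl a - g $ p $ Inr e * s $ a"
  "(g ** Umat e s) $ p $ Inr i = g $ p $ Inr i"
proof -
  have "(g ** Umat e s) $ p $ Inl a
      = (\<Sum>l\<in>UNIV. (if l = Inl a then g $ p $ l else 0) + (if l = Inr e then - g $ p $ l * s $ a else 0))"
    unfolding matrix_matrix_mult_def vec_lambda_beta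
    by (rule sum.cong) (auto simp: Umat_def split: sum.split)
  then show "(g ** Umat e s) $ p $ Inl a = g $ p $ Inl a - g $ p $ Inr e * s $ a"
    by (simp add: sum.distrib)
  have "(g ** Umat e s) $ p $ Inr i = (\<Sum>l\<in>UNIV. (if l = Inr i then g $ p $ l else 0))"
    unfolding matrix_matrix_mult_def vec_lambda_beta
    by (rule sum.cong) (auto simp: Umat_def split: sum.split)
  then show "(g ** Umat e s) $ p $ Inr i = g $ p $ Inr i" by simp
qed

lemma mat_eqI_sum:
  fixes g h :: "('k::finite,'j::finite) mat"
  assumes "\<And>p a. g $ p $ Inl a = h $ p $ Inl a" "\<And>p i. g $ p $ Inr i = h $ p $ Inr i"
  shows "g = h"
  unfolding vec_eq_iff
proof (intro allI)
  show "g $ p $ q = h $ p $ q" for p q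
    by (cases q) (simp_all add: assms)
qed

lemma Umat_add: "Umat e s ** Umat e t = (Umat e (s + t) :: ('k::finite,'j::finite) mat)"
  by (rule mat_eqI_sum; simp only: mult_Umat) (auto simp: Umat_def algebra_simps split: sum.split)

lemma Umat_0: "Umat e 0 = (mat 1 :: ('k::finite,'j::finite) mat)"
  by (auto simp: Umat_def mat_def vec_eq_iff split: sum.split)

lemma Umat_cancel [simp]:
  "g ** Umat e (- s) ** Umat e s = g" "g ** Umat e s ** Umat e (- s) = g"
  by (simp_all flip: matrix_mul_assoc add: Umat_add Umat_0)

text \<open>Cramer's rule: the adjugate, polynomial in the entries and hence continuous on all matrices.
  It is the inverse only where the determinant is one.\<close>
definition sl_inv :: "real ^ 'n ^ 'n \<Rightarrow> real ^ 'n ^ 'n" where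
  "sl_inv A = (\<chi> i k. det (\<chi> p q. if q = i then axis k 1 $ p else A $ p $ q))"

lemma sl_inv_right [simp]:
  fixes A :: "real ^ 'n ^ 'n"
  assumes "det A = 1"
  shows "A ** sl_inv A = mat 1"
proof -
  have "A *v column k (sl_inv A) = axis k 1" for k
    using cramer[of A "column k (sl_inv A)" "axis k 1"] assms
    by (simp add: sl_inv_def column_def)
  then have "(A ** sl_inv A) $ i $ k = axis k 1 $ i" for i k
    unfolding matrix_matrix_mult_def matrix_vector_mult_def column_def
    by (simp add: vec_eq_iff)
  then show ?thesis
    by (auto simp: vec_eq_iff mat_def axis_def)
qed

lemma sl_inv_left [simp]: "det A = 1 \<Longrightarrow> sl_inv A ** A = mat 1"
  by (simp add: matrix_left_right_inverse1)

lemma det_sl_inv [simp]: "det A = 1 \<Longrightarrow> det (sl_inv A) = 1"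
  by (metis det_I det_mul mult_1 sl_inv_right)

lemma sl_inv_cancel [simp]:
  assumes "det A = 1"
  shows "A ** (sl_inv A ** B) = B" "sl_inv A ** (A ** B) = B"
    "B ** A ** sl_inv A = B" "B ** sl_inv A ** A = B"
  using assms by (simp_all add: matrix_mul_assoc) (simp_all flip: matrix_mul_assoc)

section \<open>Continuity of the matrix operations\<close>

lemma continuous_on_matrix_mult [continuous_intros]:
  fixes f g :: "'a::topological_space \<Rightarrow> real ^ 'n ^ 'n"
  assumes "continuous_on S f" "continuous_on S g"
  shows "continuous_on S (\<lambda>x. f x ** g x)"
  unfolding matrix_matrix_mult_def by (intro continuous_intros assms)

lemma continuous_on_det [continuous_intros]:
  fixes f :: "'a::topological_space \<Rightarrow> real ^ 'n ^ 'n"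
  assumes "continuous_on S f"
  shows "continuous_on S (\<lambda>x. det (f x))"
  unfolding det_def by (intro continuous_intros assms)

lemma continuous_on_sl_inv [continuous_intros]:
  fixes f :: "'a::topological_space \<Rightarrow> real ^ 'n ^ 'n"
  assumes "continuous_on S f"
  shows "continuous_on S (\<lambda>x. sl_inv (f x))"
proof -
  have "continuous_on S (\<lambda>x. (if q = i then axis k 1 $ p else f x $ p $ q :: real))" for q i p k
    by (cases "q = i") (auto intro!: continuous_intros assms)
  then show ?thesis
    unfolding sl_inv_def by (intro continuous_intros)
qed

lemma continuous_on_Umat [continuous_intros]:
  fixes f :: "'a::topological_space \<Rightarrow> real ^ 'k"
  assumes "continuous_on S f"
  shows "continuous_on S (\<lambda>x. Umat e (f x) :: ('k::finite,'j::finite) mat)"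
proof -
  have "continuous_on S (\<lambda>x. (Umat e (f x) :: ('k,'j) mat) $ p $ q)" for p q
  proof (cases "\<exists>a. p = Inr e \<and> q = Inl a")
    case True
    then show ?thesis using assms by (auto simp: Umat_def intro!: continuous_intros)
  next
    case False
    then have "(Umat e (f x) :: ('k,'j) mat) $ p $ q = (if p = q then 1 else 0)" for x
      by (auto simp: Umat_def split: sum.split)
    then show ?thesis by simp
  qed
  then have "continuous_on S (\<lambda>x. \<chi> p q. (Umat e (f x) :: ('k,'j) mat) $ p $ q)"
    by (rule continuous_on_vec_lambda[OF continuous_on_vec_lambda])
  then show ?thesis by simp
qed

lemma closed_SLn: "closed (SLn :: ('k::finite,'j::finite) mat set)"
  unfolding SLn_def by (intro closed_Collect_eq continuous_intros)

section \<open>The group \<open>H\<close>\<close>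

lemma row_mult: "axis p (1::real) v* g = g $ p"
proof -
  have "axis p (1::real) $ i * g $ i $ j = (if i = p then g $ i $ j else 0)" for i j
    by (simp add: axis_def)
  then show ?thesis
    by (simp add: vector_matrix_mult_def vec_eq_iff)
qed

lemma row_matrix_mult: "(g ** h) $ p = (g $ p :: real ^ 'n) v* h"
  by (simp flip: row_mult add: vector_matrix_mul_assoc)

lemma Hgrp_iff: "g \<in> Hgrp e \<longleftrightarrow> det g = 1 \<and> g $ Inr e = axis (Inr e) 1"
  by (simp add: Hgrp_def SLn_def row_mult)

lemma closed_Hgrp: "closed (Hgrp e :: ('k::finite,'j::finite) mat set)"
proof -
  have "Hgrp e = {g :: ('k,'j) mat. det g = 1 \<and> g $ Inr e = axis (Inr e) 1}"
    by (auto simp: Hgrp_iff)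
  then show ?thesis
    by (simp add: closed_Collect_conj closed_Collect_eq continuous_intros)
qed

text \<open>The last row of \<open>h ** g\<close> is the row vector \<open>(0,...,0,1)h\<close>
  times \<open>g\<close>, and \<open>h\<close> fixes that vector. Hence every quantity read off the
  last row, in particular \<open>svec\<close> and \<open>wpart\<close>, is invariant under left
  multiplication by \<open>H\<close>.\<close>

lemma Hgrp_mult_row: "h \<in> Hgrp e \<Longrightarrow> (h ** g) $ Inr e = g $ Inr e"
  by (simp add: row_matrix_mult Hgrp_iff row_mult)

lemma Hgrp_mult: "g \<in> Hgrp e \<Longrightarrow> h \<in> Hgrp e \<Longrightarrow> g ** h \<in> Hgrp e"
  by (simp add: Hgrp_iff det_mul Hgrp_mult_row)

lemma Hgrp_inv:
  assumes "g \<in> Hgrp e"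
  shows "sl_inv g \<in> Hgrp e"
proof -
  have "sl_inv g $ Inr e = (g ** sl_inv g) $ Inr e"
    using assms Hgrp_mult_row by metis
  also have "\<dots> = axis (Inr e) 1"
    using assms by (auto simp: Hgrp_iff vec_eq_iff mat_def axis_def)
  finally show ?thesis using assms by (simp add: Hgrp_iff)
qed

section \<open>Coordinates on the open cell \<open>HQU\<close>\<close>

text \<open>On \<open>HQ\<close> this is the coordinate \<open>w\<close> in
  \<open>h ** Rmat e w\<close>. It is defined on all matrices so that it can serve as a linear
  projection of the whole matrix space.\<close>

definition wpart :: "'j \<Rightarrow> ('k::finite,'j::finite) mat \<Rightarrow> real ^ 'j" where
  "wpart e g = (\<chi> i. g $ Inr e $ Inr i)"

lemma Rmat_row: "Rmat e w $ Inr e = (\<chi> q. case q of Inl a \<Rightarrow> 0 | Inr i \<Rightarrow> w $ i)"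
  by (auto simp: Rmat_def vec_eq_iff split: sum.split)

lemma Rmat_row_nth [simp]: "Rmat e w $ Inr e $ Inl a = 0" "Rmat e w $ Inr e $ Inr i = w $ i"
  by (simp_all add: Rmat_row)

text \<open>\<open>d\<close> and \<open>Rmat e (wpart e d)\<close> have the same last row, so their
  quotient fixes \<open>(0,...,0,1)\<close> and lies in \<open>H\<close>.\<close>

lemma HQ_decomp:
  fixes d :: "('k::finite,'j::finite) mat"
  assumes "det d = 1" "\<And>a. d $ Inr e $ Inl a = 0" "d $ Inr e $ Inr e > 0"
  shows "\<exists>h\<in>Hgrp e. d = h ** Rmat e (wpart e d)" "wpart e d \<in> Wpos e"
proof -
  let ?R = "Rmat e (wpart e d) :: ('k,'j) mat"
  show w: "wpart e d \<in> Wpos e"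
    using assms by (simp add: Wpos_def wpart_def)
  have row: "d $ Inr e = ?R $ Inr e"
    using assms by (auto simp: vec_eq_iff wpart_def Rmat_row split: sum.split)
  have "(d ** sl_inv ?R) $ Inr e = (?R ** sl_inv ?R) $ Inr e"
    by (simp only: row_matrix_mult row)
  also have "\<dots> = axis (Inr e) 1"
    using w by (auto simp: vec_eq_iff mat_def axis_def)
  finally have "d ** sl_inv ?R \<in> Hgrp e"
    using assms w by (simp add: Hgrp_iff det_mul)
  then show "\<exists>h\<in>Hgrp e. d = h ** Rmat e (wpart e d)"
    using w by (metis det_Rmat sl_inv_cancel(4))
qed

lemma HQ_iff:
  "d \<in> HQ e \<longleftrightarrow> det d = 1 \<and> (\<forall>a. d $ Inr e $ Inl a = 0) \<and> d $ Inr e $ Inr e > 0"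
proof
  assume "d \<in> HQ e"
  then show "det d = 1 \<and> (\<forall>a. d $ Inr e $ Inl a = 0) \<and> d $ Inr e $ Inr e > 0"
    by (auto simp: HQ_def Hgrp_mult_row det_mul Hgrp_iff[THEN iffD1] Wpos_def)
next
  assume "det d = 1 \<and> (\<forall>a. d $ Inr e $ Inl a = 0) \<and> d $ Inr e $ Inr e > 0"
  then show "d \<in> HQ e"
    using HQ_decomp[of d e] by (auto simp: HQ_def)
qed

text \<open>If the last diagonal entry of \<open>g\<close> is positive then \<open>g = d U(-s)\<close> for a unique \<open>d \<in> HQ\<close> and a
  unique \<open>s\<close>, namely \<open>d = dpart e g\<close> and \<open>s = svec e g\<close>.\<close>
definition svec :: "'j \<Rightarrow> ('k::finite,'j::finite) mat \<Rightarrow> real ^ 'k" where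
  "svec e g = (\<chi> a. g $ Inr e $ Inl a / g $ Inr e $ Inr e)"

definition dpart :: "'j \<Rightarrow> ('k::finite,'j::finite) mat \<Rightarrow> ('k,'j) mat" where
  "dpart e g = g ** Umat e (svec e g)"

lemma dpart_in_HQ: "det g = 1 \<Longrightarrow> g $ Inr e $ Inr e > 0 \<Longrightarrow> dpart e g \<in> HQ e"
  by (simp add: HQ_iff dpart_def det_mul mult_Umat svec_def)

lemma dpart_svec: "dpart e g ** Umat e (- svec e g) = g"
  by (simp add: dpart_def)

lemma svec_mult_Umat:
  assumes "d $ Inr e $ Inr e > 0"
  shows "svec e (d ** Umat e s) = svec e d - s"
  using assms by (simp add: svec_def mult_Umat vec_eq_iff field_simps)

lemma svec_HQ: "d \<in> HQ e \<Longrightarrow> svec e d = 0"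
  by (simp add: HQ_iff svec_def vec_eq_iff)

lemma HQ_Umat:
  assumes "d \<in> HQ e"
  shows "svec e (d ** Umat e (- s)) = s" "dpart e (d ** Umat e (- s)) = d"
    "(d ** Umat e (- s)) $ Inr e $ Inr e > 0" "det (d ** Umat e (- s)) = 1"
proof -
  show s: "svec e (d ** Umat e (- s)) = s"
    using assms by (simp add: svec_mult_Umat svec_HQ HQ_iff)
  show "dpart e (d ** Umat e (- s)) = d"
    by (simp add: dpart_def s)
  show "(d ** Umat e (- s)) $ Inr e $ Inr e > 0" "det (d ** Umat e (- s)) = 1"
    using assms by (simp_all add: mult_Umat HQ_iff det_mul)
qed

definition DU :: "'j \<Rightarrow> ('k::finite,'j::finite) mat set \<Rightarrow> (real ^ 'k) set \<Rightarrow> ('k,'j) mat set" where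
  "DU e D A = {d ** Umat e (- a) | d a. d \<in> D \<and> a \<in> A}"

text \<open>The factors of \<open>d ** Umat e (- a)\<close> with \<open>d\<close> in
  \<open>HQ\<close> are recovered by \<open>dpart\<close> and \<open>svec\<close>. Membership in the
  product set thereby becomes a condition on two coordinate maps, which gives access to Borel sets,
  neighbourhoods and null sets.\<close>

lemma DU_iff:
  assumes "D \<subseteq> HQ e"
  shows "g \<in> DU e D A \<longleftrightarrow> det g = 1 \<and> g $ Inr e $ Inr e > 0 \<and> dpart e g \<in> D \<and> svec e g \<in> A"
proof
  assume "g \<in> DU e D A"
  then obtain d a where da: "d \<in> D" "a \<in> A" "g = d ** Umat e (- a)"
    by (auto simp: DU_def)
  with assms have "d \<in> HQ e" by blast
  from HQ_Umat[OF this, of a] da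
  show "det g = 1 \<and> g $ Inr e $ Inr e > 0 \<and> dpart e g \<in> D \<and> svec e g \<in> A"
    by metis
next
  assume "det g = 1 \<and> g $ Inr e $ Inr e > 0 \<and> dpart e g \<in> D \<and> svec e g \<in> A"
  then show "g \<in> DU e D A"
    unfolding DU_def using dpart_svec[of e g] by (metis (mono_tags, lifting) mem_Collect_eq)
qed

lemma DU_mono: "D \<subseteq> D' \<Longrightarrow> A \<subseteq> A' \<Longrightarrow> DU e D A \<subseteq> DU e D' A'"
  by (auto simp: DU_def)

lemma compact_DU:
  assumes "compact D" "compact A"
  shows "compact (DU e D A)"
proof -
  have "DU e D A = (\<lambda>(d, a). d ** Umat e (- a)) ` (D \<times> A)"
    by (auto simp: DU_def)
  moreover have "compact \<dots>"
    unfolding case_prod_beta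
    by (intro compact_continuous_image compact_Times assms continuous_intros)
  ultimately show ?thesis by simp
qed

lemma continuous_on_svec:
  "continuous_on {g. g $ Inr e $ Inr e > 0} (svec e :: ('k::finite,'j::finite) mat \<Rightarrow> _)"
  unfolding svec_def[abs_def] by (intro continuous_intros) auto

lemma continuous_on_dpart:
  "continuous_on {g. g $ Inr e $ Inr e > 0} (dpart e :: ('k::finite,'j::finite) mat \<Rightarrow> _)"
  unfolding dpart_def[abs_def] by (intro continuous_intros continuous_on_svec)

section \<open>The quotient space\<close>

lemma GammaD: "\<gamma> \<in> Gamma \<Longrightarrow> det \<gamma> = 1"
  by (simp add: Gamma_def)

lemma Gamma_one [simp]: "mat 1 \<in> Gamma"
  by (simp add: Gamma_def) (simp add: mat_def)

lemma Gamma_mult: "\<gamma> \<in> Gamma \<Longrightarrow> \<delta> \<in> Gamma \<Longrightarrow> \<gamma> ** \<delta> \<in> Gamma"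
  by (simp add: Gamma_def det_mul) (simp add: matrix_matrix_mult_def Ints_sum Ints_mult)

lemma Gamma_inv:
  assumes "\<gamma> \<in> Gamma"
  shows "sl_inv \<gamma> \<in> Gamma"
proof -
  have "sl_inv \<gamma> $ p $ q \<in> \<int>" for p q
    using assms unfolding sl_inv_def det_def Gamma_def
    by (auto intro!: Ints_sum Ints_mult Ints_prod simp: axis_def)
  then show ?thesis
    using assms by (simp add: Gamma_def)
qed

section \<open>Discreteness of \<open>Gamma\<close>\<close>

lemma finite_Gamma_bounded:
  assumes "bounded (S :: ('k::finite,'j::finite) mat set)"
  shows "finite (Gamma \<inter> S)"
proof -
  obtain C where C: "\<And>g. g \<in> S \<Longrightarrow> norm g \<le> C"
    using assms by (auto simp: bounded_iff)
  define I where "I = {x :: real. x \<in> \<int> \<and> \<bar>x\<bar> \<le> C}"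
  have finI: "finite I"
    unfolding I_def using finite_int_segment[of "-C" C]
    by (rule rev_finite_subset) auto
  have fin: "finite {v :: 'a ^ 'n. \<forall>i. v $ i \<in> T}" if "finite T" for T :: "'a set"
  proof (rule finite_subset)
    show "{v :: 'a ^ 'n. \<forall>i. v $ i \<in> T} \<subseteq> vec_lambda ` (UNIV \<rightarrow>\<^sub>E T)"
      by (rule subsetI, rule_tac x = "vec_nth x" in image_eqI) auto
    show "finite (vec_lambda ` (UNIV \<rightarrow>\<^sub>E T) :: ('a ^ 'n) set)"
      using that by (intro finite_imageI finite_PiE) auto
  qed
  have "Gamma \<inter> S \<subseteq> {g. \<forall>p. g $ p \<in> {v. \<forall>q. v $ q \<in> I}}"
  proof (clarsimp simp: I_def Gamma_def)
    fix g p q assume "g \<in> S"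
    have "\<bar>g $ p $ q\<bar> \<le> norm (g $ p)" by (rule component_le_norm_cart)
    also have "\<dots> \<le> norm g" by (rule Finite_Cartesian_Product.norm_nth_le)
    finally show "\<bar>g $ p $ q\<bar> \<le> C" using C[OF \<open>g \<in> S\<close>] by simp
  qed
  then show ?thesis
    using fin[OF fin[OF finI]] finite_subset by blast
qed

lemma countable_Gamma: "countable (Gamma :: ('k::finite,'j::finite) mat set)"
proof -
  have "Gamma = (\<Union>n. Gamma \<inter> cball (0 :: ('k,'j) mat) (real n))"
  proof (intro equalityI subsetI)
    fix \<gamma> :: "('k,'j) mat" assume "\<gamma> \<in> Gamma"
    moreover obtain n where "norm \<gamma> \<le> real n" using real_arch_simple by blast
    ultimately show "\<gamma> \<in> (\<Union>n. Gamma \<inter> cball 0 (real n))" by auto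
  qed auto
  moreover have "countable (\<Union>n. Gamma \<inter> cball (0 :: ('k,'j) mat) (real n))"
    by (rule countable_UN[OF countableI_type], rule countable_finite, rule finite_Gamma_bounded, rule bounded_cball)
  ultimately show ?thesis by simp
qed

text \<open>Such a \<open>\<gamma>\<close> equals \<open>(\<gamma> ** g) ** sl_inv g\<close>, so it
  lies in the continuous image of the compact set \<open>C \<times> K\<close>, and a bounded set
  contains only finitely many integer matrices.\<close>

lemma finite_Gamma_meets:
  fixes K C :: "('k::finite,'j::finite) mat set"
  assumes "compact K" "compact C" "K \<subseteq> SLn"
  shows "finite {\<gamma> \<in> Gamma. \<exists>g\<in>K. \<gamma> ** g \<in> C}"
proof -
  let ?S = "(\<lambda>(c, g). c ** sl_inv g) ` (C \<times> K)"
  have "compact ?S"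
    unfolding case_prod_beta
    by (intro compact_continuous_image compact_Times assms continuous_intros)
  then have "finite (Gamma \<inter> ?S)"
    by (intro finite_Gamma_bounded compact_imp_bounded)
  moreover have "{\<gamma> \<in> Gamma. \<exists>g\<in>K. \<gamma> ** g \<in> C} \<subseteq> Gamma \<inter> ?S"
  proof
    fix \<gamma> assume "\<gamma> \<in> {\<gamma> \<in> Gamma. \<exists>g\<in>K. \<gamma> ** g \<in> C}"
    then obtain g where "\<gamma> \<in> Gamma" "g \<in> K" "\<gamma> ** g \<in> C" by blast
    moreover from this have "\<gamma> = (\<gamma> ** g) ** sl_inv g"
      using assms by (auto simp: SLn_def)
    ultimately show "\<gamma> \<in> Gamma \<inter> ?S"
      by (force intro: image_eqI[where x = "(\<gamma> ** g, g)"])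
  qed
  ultimately show ?thesis by (rule rev_finite_subset)
qed

section \<open>Cosets and the quotient topology\<close>

lemma coset_eq_iff: "coset g = coset h \<longleftrightarrow> (\<exists>\<gamma>\<in>Gamma. g = \<gamma> ** h)"
proof
  assume "coset g = coset h"
  moreover have "g \<in> coset g"
    unfolding coset_def using Gamma_one by (metis (mono_tags, lifting) matrix_mul_lid mem_Collect_eq)
  ultimately show "\<exists>\<gamma>\<in>Gamma. g = \<gamma> ** h"
    by (auto simp: coset_def)
next
  assume "\<exists>\<gamma>\<in>Gamma. g = \<gamma> ** h"
  then obtain \<gamma> where \<gamma>: "\<gamma> \<in> Gamma" "g = \<gamma> ** h" by blast
  have "\<delta> ** g \<in> coset h" if "\<delta> \<in> Gamma" for \<delta>
    using that \<gamma> Gamma_mult[of \<delta> \<gamma>] by (auto simp: coset_def matrix_mul_assoc)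
  moreover have "\<delta> ** h \<in> coset g" if "\<delta> \<in> Gamma" for \<delta>
  proof -
    have "\<delta> ** h = (\<delta> ** sl_inv \<gamma>) ** g"
      using \<gamma> by (simp add: GammaD matrix_mul_assoc)
    then show ?thesis
      using that \<gamma> Gamma_mult Gamma_inv by (auto simp: coset_def)
  qed
  ultimately show "coset g = coset h"
    by (force simp: coset_def)
qed

lemma coset_in_Xsp [simp]: "det g = 1 \<Longrightarrow> coset g \<in> Xsp"
  by (auto simp: Xsp_def SLn_def)

lemma XspE:
  assumes "x \<in> Xsp"
  obtains g where "det g = 1" "x = coset g"
  using assms by (auto simp: Xsp_def SLn_def)

lemma Xact_coset [simp]: "Xact (coset g) h = coset (g ** h)"
  by (auto simp: Xact_def coset_def image_iff matrix_mul_assoc)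

lemma coset_image_iff:
  assumes "det g = 1"
  shows "coset g \<in> coset ` S \<longleftrightarrow> (\<exists>\<gamma>\<in>Gamma. \<gamma> ** g \<in> S)"
  unfolding image_iff using coset_eq_iff by metis

lemma topspace_Xtop [simp]: "topspace (Xtop :: ('k::finite,'j::finite) mat set topology) = Xsp"
proof
  show "topspace (Xtop :: ('k,'j) mat set topology) \<subseteq> Xsp"
    using openin_topspace[of "Xtop :: ('k,'j) mat set topology"] unfolding Xtop_def openin_quot_top Xsp_def by simp
  have "openin (Xtop :: ('k,'j) mat set topology) Xsp"
    by (simp add: Xtop_def openin_quot_top Xsp_def cong: conj_cong)
  then show "Xsp \<subseteq> topspace (Xtop :: ('k,'j) mat set topology)"
    by (rule openin_subset)
qed

text \<open>The projection is an open map: the saturation of \<open>V\<close> is the union of its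
  translates under \<open>Gamma\<close>, each of which is open in \<open>SLn\<close>.\<close>

lemma openin_coset_image:
  fixes V :: "('k::finite,'j::finite) mat set"
  assumes "openin (top_of_set SLn) V"
  shows "openin Xtop (coset ` V)"
proof -
  have V: "V \<subseteq> SLn" using assms by (rule openin_imp_subset)
  have "{g \<in> SLn. coset g \<in> coset ` V} = (\<Union>\<gamma>\<in>Gamma. SLn \<inter> (\<lambda>g. \<gamma> ** g) -` V)"
    by (simp add: coset_image_iff SLn_def set_eq_iff cong: conj_cong)
  moreover have "openin (top_of_set SLn) (SLn \<inter> (\<lambda>g. \<gamma> ** g) -` V)" if "\<gamma> \<in> Gamma" for \<gamma>
  proof (rule continuous_openin_preimage[OF _ _ assms])
    show "continuous_on SLn (\<lambda>g. \<gamma> ** g)" by (intro continuous_intros)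
    show "(**) \<gamma> \<in> SLn \<rightarrow> SLn" using that by (auto simp: SLn_def det_mul GammaD)
  qed
  ultimately have "openin (top_of_set SLn) {g \<in> SLn. coset g \<in> coset ` V}"
    by (simp only:) (blast intro: openin_Union)
  then show ?thesis
    using V by (auto simp: Xtop_def openin_quot_top)
qed

section \<open>Borel sets of the quotient\<close>

lemma openin_Xtop_Pow: "Collect (openin Xtop) \<subseteq> Pow Xsp"
  using openin_subset by fastforce

lemma space_Xborel [simp]: "space Xborel = Xsp"
  by (simp add: Xborel_def openin_Xtop_Pow space_measure_of_conv)

lemma sets_Xborel: "sets Xborel = sigma_sets Xsp (Collect (openin Xtop))"
  by (simp add: Xborel_def openin_Xtop_Pow sets_measure_of)

lemma openin_Xborel: "openin Xtop U \<Longrightarrow> U \<in> sets Xborel"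
  by (simp add: sets_Xborel sigma_sets.Basic)

lemma closedin_Xborel: "closedin Xtop U \<Longrightarrow> U \<in> sets Xborel"
  using sets.compl_sets[OF openin_Xborel, of "Xsp - U"]
  by (auto simp: closedin_def double_diff)

text \<open>If \<open>a\<close> and \<open>b\<close> are close to \<open>g\<close> then
  \<open>a ** sl_inv b\<close> is close to the identity. When the cosets agree this quotient is an
  integer matrix, and an integer matrix at distance less than one from the identity is the
  identity.\<close>

lemma coset_locally_injective:
  fixes g :: "('k::finite,'j::finite) mat"
  assumes "g \<in> SLn"
  shows "\<exists>V. open V \<and> g \<in> V \<and> inj_on coset (V \<inter> SLn)"
proof -
  define f where "f = (\<lambda>p. fst p ** sl_inv (snd p) :: ('k,'j) mat)"
  have "continuous_on UNIV f"
    unfolding f_def by (intro continuous_intros)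
  then have "open (f -` ball (mat 1) 1)"
    by (intro open_vimage) auto
  moreover have "(g, g) \<in> f -` ball (mat 1) 1"
    using assms by (simp add: f_def SLn_def)
  ultimately obtain A B where AB: "open A" "open B" "g \<in> A" "g \<in> B" "A \<times> B \<subseteq> f -` ball (mat 1) 1"
    by (auto elim: open_prod_elim)
  have "inj_on coset (A \<inter> B \<inter> SLn)"
  proof (rule inj_onI)
    fix a b assume a: "a \<in> A \<inter> B \<inter> SLn" and b: "b \<in> A \<inter> B \<inter> SLn" and "coset a = coset b"
    then obtain \<gamma> where \<gamma>: "\<gamma> \<in> Gamma" "a = \<gamma> ** b"
      by (auto simp: coset_eq_iff)
    have "f (a, b) = \<gamma>"
      using b by (simp add: f_def \<gamma>(2) SLn_def)
    then have near: "norm (mat 1 - \<gamma>) < 1"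
      using AB(5) a b by (force simp: dist_norm)
    have "(mat 1 :: ('k,'j) mat) $ p $ q = \<gamma> $ p $ q" for p q
    proof (rule Ints_eq_abs_less1[THEN iffD2])
      show "mat 1 $ p $ q \<in> \<int>" by (simp add: mat_def)
      show "\<gamma> $ p $ q \<in> \<int>" using \<gamma>(1) by (simp add: Gamma_def)
      have "\<bar>(mat 1 - \<gamma>) $ p $ q\<bar> \<le> norm ((mat 1 - \<gamma>) $ p)" by (rule component_le_norm_cart)
      also have "\<dots> \<le> norm (mat 1 - \<gamma>)" by (rule Finite_Cartesian_Product.norm_nth_le)
      finally show "\<bar>mat 1 $ p $ q - \<gamma> $ p $ q\<bar> < 1" using near by simp
    qed
    then have "mat 1 = \<gamma>" by (simp add: vec_eq_iff)
    then show "a = b" using \<gamma>(2) by (simp add: matrix_mul_lid flip: \<open>mat 1 = \<gamma>\<close>)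
  qed
  then show ?thesis
    using AB by (intro exI[of _ "A \<inter> B"]) auto
qed

text \<open>By second countability, countably many open sets on which \<open>coset\<close> is
  injective cover \<open>SLn\<close>. The section inverts \<open>coset\<close> on the first of them
  whose image contains \<open>x\<close>. It transfers measurability questions on the quotient to the
  matrix space.\<close>

lemma measurable_section:
  obtains \<sigma> :: "('k::finite,'j::finite) mat set \<Rightarrow> ('k,'j) mat"
  where "\<sigma> \<in> borel_measurable Xborel" "\<And>x. x \<in> Xsp \<Longrightarrow> det (\<sigma> x) = 1 \<and> coset (\<sigma> x) = x"
proof -
  obtain \<B> :: "('k,'j) mat set set" where \<B>: "countable \<B>" "topological_basis \<B>"
    using ex_countable_basis by blast
  define \<C> where "\<C> = {U \<in> \<B>. inj_on coset (U \<inter> SLn)}"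
  have cover: "\<exists>U\<in>\<C>. g \<in> U" if g: "g \<in> SLn" for g
  proof -
    obtain V where "open V" "g \<in> V" "inj_on coset (V \<inter> SLn)"
      using coset_locally_injective[OF g] by blast
    moreover from this obtain U where "U \<in> \<B>" "g \<in> U" "U \<subseteq> V"
      using \<B>(2) by (metis topological_basisE)
    ultimately show ?thesis
      unfolding \<C>_def by (blast intro: inj_on_subset)
  qed
  \<comment> \<open>Nonemptiness ensures that \<open>from_nat_into\<close> takes all its values in
    \<open>\<C>\<close>.\<close>
  have "mat 1 \<in> (SLn :: ('k,'j) mat set)" by (simp add: SLn_def)
  then have ne: "\<C> \<noteq> {}" using cover by blast
  have cnt: "countable \<C>" using \<B>(1) by (simp add: \<C>_def)
  define V where "V i = from_nat_into \<C> i \<inter> SLn" for i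
  have in\<C>: "from_nat_into \<C> i \<in> \<C>" for i
    using ne by (rule from_nat_into)
  have Vinj: "inj_on coset (V i)" for i
    using in\<C>[of i] by (simp add: V_def \<C>_def)
  have Vopen: "open (from_nat_into \<C> i)" for i
    using in\<C>[of i] \<B>(2) by (simp add: \<C>_def topological_basis_open)
  have Vcover: "\<exists>i. \<exists>g\<in>V i. coset g = x" if x: "x \<in> Xsp" for x
  proof -
    obtain g where g: "g \<in> SLn" "x = coset g" using x by (auto simp: Xsp_def)
    then obtain U where "U \<in> \<C>" "g \<in> U" using cover by blast
    then show ?thesis
      using g from_nat_into_surj[OF cnt \<open>U \<in> \<C>\<close>] by (force simp: V_def)
  qed
  define i where "i x = (LEAST i. x \<in> coset ` V i)" for x
  define \<sigma> where "\<sigma> x = the_inv_into (V (i x)) coset x" for x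
  have ix: "x \<in> coset ` V (i x)" if "x \<in> Xsp" for x
    unfolding i_def by (rule LeastI_ex) (use Vcover[OF that] in blast)
  have \<sigma>: "\<sigma> x \<in> V (i x)" "coset (\<sigma> x) = x" if "x \<in> Xsp" for x
    unfolding \<sigma>_def using the_inv_into_into[OF Vinj ix[OF that] order_refl] f_the_inv_into_f[OF Vinj ix[OF that]]
    by blast+
  have i_eq: "i x = n" if "x \<in> coset ` V n" "\<forall>m<n. x \<notin> coset ` V m" for x n
    unfolding i_def by (rule Least_equality) (use that not_le in blast)+
  have i_min: "x \<notin> coset ` V m" if "m < i x" for x m
    using not_less_Least[OF that[unfolded i_def]] .
  have VX: "coset ` V n \<subseteq> Xsp" for n by (auto simp: V_def Xsp_def)
  show thesis
  proof (rule that)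
    show "det (\<sigma> x) = 1 \<and> coset (\<sigma> x) = x" if "x \<in> Xsp" for x
      using \<sigma>[OF that] by (auto simp: V_def SLn_def)
    show "\<sigma> \<in> borel_measurable Xborel"
    proof (rule borel_measurableI)
      fix S :: "('k,'j) mat set" assume "open S"
      \<comment> \<open>Sort the points by the first index \<open>n\<close> whose image contains
        them; on that layer the representative is the unique one in \<open>V n\<close>. All the
        images involved are open, so their differences are Borel.\<close>
      have "\<sigma> -` S \<inter> space Xborel = (\<Union>n. coset ` (V n \<inter> S) - (\<Union>m<n. coset ` V m))" (is "?L = ?R")
      proof (intro equalityI subsetI)
        fix x assume x: "x \<in> ?L"
        then have "x \<in> coset ` (V (i x) \<inter> S)"
          using \<sigma>[of x] by (auto simp: image_iff intro!: bexI[of _ "\<sigma> x"])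
        moreover have "x \<notin> (\<Union>m<i x. coset ` V m)"
          using i_min[of _ x] by blast
        ultimately show "x \<in> ?R" by blast
      next
        fix x assume "x \<in> ?R"
        then obtain n g where n: "x = coset g" "g \<in> V n" "g \<in> S" "\<forall>m<n. x \<notin> coset ` V m" by auto
        then have X: "x \<in> Xsp" using VX by blast
        have "i x = n" using i_eq[of x n] n by blast
        then have "\<sigma> x = g"
          unfolding \<sigma>_def using n the_inv_into_f_f[OF Vinj n(2)] by simp
        then show "x \<in> ?L" using X n by simp
      qed
      moreover have "coset ` (V n \<inter> S) \<in> sets Xborel" "coset ` V n \<in> sets Xborel" for n
        unfolding V_def Int_commute[of _ SLn] Int_assoc
        by (intro openin_Xborel openin_coset_image openin_open_Int open_Int Vopen \<open>open S\<close>)+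
      ultimately show "\<sigma> -` S \<inter> space Xborel \<in> sets Xborel" by auto
    qed
  qed
qed

text \<open>\<open>E\<close> is the preimage, under a Borel section, of its own full preimage in
  \<open>SLn\<close>.\<close>

lemma Xborel_from_preimage:
  fixes E :: "('k::finite,'j::finite) mat set set"
  assumes "E \<subseteq> Xsp" "{g \<in> SLn. coset g \<in> E} \<in> sets borel"
  shows "E \<in> sets Xborel"
proof -
  obtain \<sigma> :: "('k,'j) mat set \<Rightarrow> ('k,'j) mat"
    where \<sigma>: "\<sigma> \<in> borel_measurable Xborel" "\<And>x. x \<in> Xsp \<Longrightarrow> det (\<sigma> x) = 1 \<and> coset (\<sigma> x) = x"
    using measurable_section by blast
  have "E = \<sigma> -` {g \<in> SLn. coset g \<in> E} \<inter> space Xborel"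
    using assms(1) \<sigma>(2) by (auto simp: SLn_def)
  also have "\<dots> \<in> sets Xborel"
    using \<sigma>(1) assms(2) by (rule measurable_sets)
  finally show ?thesis .
qed

lemma borel_mult_vimage:
  fixes S :: "(real ^ 'n ^ 'n) set" and h :: "real ^ 'n ^ 'n"
  shows "S \<in> sets borel \<Longrightarrow> {g. h ** g \<in> S} \<in> sets borel"
proof -
  assume S: "S \<in> sets borel"
  have "(\<lambda>g :: real ^ 'n ^ 'n. h ** g) \<in> borel_measurable borel"
    by (intro borel_measurable_continuous_onI continuous_intros)
  from measurable_sets[OF this S] show ?thesis
    by (simp add: vimage_def)
qed

text \<open>The saturation of \<open>S\<close> is a union of translates indexed by the countable
  group \<open>Gamma\<close>, each Borel as a preimage under a continuous map.\<close>

lemma coset_image_Xborel: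
  fixes S :: "('k::finite,'j::finite) mat set"
  assumes "S \<in> sets borel" "S \<subseteq> SLn"
  shows "coset ` S \<in> sets Xborel"
proof (rule Xborel_from_preimage)
  show "coset ` S \<subseteq> Xsp" using assms(2) by (auto simp: Xsp_def)
  have "{g \<in> SLn. coset g \<in> coset ` S} = (\<Union>\<gamma>\<in>Gamma. SLn \<inter> {g. \<gamma> ** g \<in> S})"
    by (simp add: coset_image_iff SLn_def set_eq_iff cong: conj_cong)
  also have "\<dots> \<in> sets borel"
    by (intro sets.countable_UN' countable_Gamma image_subsetI sets.Int borel_closed[OF closed_SLn]
        borel_mult_vimage[OF assms(1)])
  finally show "{g \<in> SLn. coset g \<in> coset ` S} \<in> sets borel" .
qed

text \<open>A countable index set has only countably many finite subsets \<open>T\<close>, and the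
  event splits according to which \<open>T\<close> of size \<open>n\<close> is the set of hits.
  Finiteness is stated separately because \<open>card\<close> of an infinite set is
  \<open>0\<close>.\<close>

lemma measurable_card_eq:
  assumes "countable I" "\<And>\<gamma>. \<gamma> \<in> I \<Longrightarrow> {g \<in> space M. P \<gamma> g} \<in> sets M"
  shows "{g \<in> space M. finite {\<gamma> \<in> I. P \<gamma> g} \<and> card {\<gamma> \<in> I. P \<gamma> g} = n} \<in> sets M"
proof -
  let ?\<T> = "{T. T \<subseteq> I \<and> finite T \<and> card T = n}"
  have "{g \<in> space M. finite {\<gamma> \<in> I. P \<gamma> g} \<and> card {\<gamma> \<in> I. P \<gamma> g} = n}
      = (\<Union>T\<in>?\<T>. {g \<in> space M. \<forall>\<gamma>\<in>I. P \<gamma> g \<longleftrightarrow> \<gamma> \<in> T})" (is "?L = ?R")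
  proof (intro equalityI subsetI)
    show "g \<in> ?R" if "g \<in> ?L" for g
      using that by (auto intro!: exI[of _ "{\<gamma> \<in> I. P \<gamma> g}"])
    fix g assume "g \<in> ?R"
    then obtain T where T: "T \<in> ?\<T>" "g \<in> space M" "\<forall>\<gamma>\<in>I. P \<gamma> g \<longleftrightarrow> \<gamma> \<in> T" by blast
    then have "{\<gamma> \<in> I. P \<gamma> g} = T" by auto
    with T show "g \<in> ?L" by simp
  qed
  moreover have "countable ?\<T>"
    using countable_Collect_finite_subset[OF assms(1)] by (rule countable_subset[rotated]) auto
  moreover have "{g \<in> space M. \<forall>\<gamma>\<in>I. P \<gamma> g \<longleftrightarrow> \<gamma> \<in> T} \<in> sets M" for T
  proof (rule sets.sets_Collect_countable_All'[OF _ assms(1)])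
    fix \<gamma> assume "\<gamma> \<in> I"
    from assms(2)[OF this] show "{g \<in> space M. P \<gamma> g \<longleftrightarrow> \<gamma> \<in> T} \<in> sets M"
      by (cases "\<gamma> \<in> T") (auto intro: sets.sets_Collect_neg)
  qed
  ultimately show ?thesis
    by (auto intro: sets.countable_UN')
qed

section \<open>Null sets\<close>

lemma fubini_null:
  assumes "sigma_finite_measure M1" "sigma_finite_measure M2"
    and Z: "Z \<in> sets (M1 \<Otimes>\<^sub>M M2)"
    and AE: "AE x in M1. emeasure M2 (Pair x -` Z) = 0"
  shows "AE y in M2. emeasure M1 ((\<lambda>x. (x, y)) -` Z) = 0"
proof -
  interpret pair_sigma_finite M1 M2
    using assms(1,2) by (simp add: pair_sigma_finite_def)
  have "emeasure (M1 \<Otimes>\<^sub>M M2) Z = (\<integral>\<^sup>+x. emeasure M2 (Pair x -` Z) \<partial>M1)"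
    by (rule M2.emeasure_pair_measure_alt[OF Z])
  also have "\<dots> = 0"
    using AE M2.measurable_emeasure_Pair[OF Z] by (subst nn_integral_0_iff_AE) auto
  finally have "(\<integral>\<^sup>+y. emeasure M1 ((\<lambda>x. (x, y)) -` Z) \<partial>M2) = 0"
    using emeasure_pair_measure_alt2[OF Z] by simp
  then show ?thesis
    using measurable_emeasure_Pair2[OF Z]
    by (subst (asm) nn_integral_0_iff_AE) auto
qed

text \<open>The form in which Fubini is used throughout: null sections in one direction yield a
  single good parameter \<open>y\<close> in a set of positive measure. In the applications the
  section at \<open>y\<close> is a translate of the set of interest, so one \<open>y\<close>
  suffices.\<close>

lemma fubini_null_ex:
  assumes "sigma_finite_measure M1" "sigma_finite_measure M2" "Z \<in> sets (M1 \<Otimes>\<^sub>M M2)"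
    and "AE x in M1. emeasure M2 (Pair x -` Z) = 0"
    and B: "B \<in> sets M2" "emeasure M2 B \<noteq> 0"
  shows "\<exists>y\<in>B. emeasure M1 ((\<lambda>x. (x, y)) -` Z) = 0"
proof (rule ccontr)
  assume "\<not> ?thesis"
  moreover have "AE y in M2. emeasure M1 ((\<lambda>x. (x, y)) -` Z) = 0"
    using assms(1-4) by (rule fubini_null)
  ultimately have "AE y in M2. y \<notin> B"
    by (auto elim: eventually_mono)
  then have "B \<in> null_sets M2"
    using B(1) by (simp add: AE_iff_null_sets)
  with B show False by auto
qed

lemma sl_inv_unique:
  assumes "det A = 1" "A ** B = mat 1"
  shows "sl_inv A = B"
  using assms by (metis matrix_mul_rid sl_inv_cancel(2))

lemma sl_inv_sl_inv [simp]: "det A = 1 \<Longrightarrow> sl_inv (sl_inv A) = A"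
  by (rule sl_inv_unique) simp_all

lemma sl_inv_mult:
  assumes "det A = 1" "det B = 1"
  shows "sl_inv (A ** B) = sl_inv B ** sl_inv A"
proof (rule sl_inv_unique)
  show "det (A ** B) = 1" using assms by (simp add: det_mul)
  show "A ** B ** (sl_inv B ** sl_inv A) = mat 1"
    using assms by (simp add: matrix_mul_assoc)
qed

section \<open>Borel measurability of the coordinates\<close>

lemma borel_measurable_vecI:
  fixes f :: "'a \<Rightarrow> 'b::euclidean_space ^ 'n"
  assumes "\<And>i. (\<lambda>x. f x $ i) \<in> borel_measurable M"
  shows "f \<in> borel_measurable M"
  unfolding borel_measurable_euclidean_space[of f]
  using assms by (auto simp: Basis_vec_def inner_axis)

lemma borel_measurable_nth [measurable (raw)]:
  fixes f :: "'a \<Rightarrow> 'b::euclidean_space ^ 'n"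
  assumes "f \<in> borel_measurable M"
  shows "(\<lambda>x. f x $ i) \<in> borel_measurable M"
  by (rule borel_measurable_continuous_on[OF _ assms]) (intro continuous_intros)

lemma borel_measurable_matrix_mult [measurable (raw)]:
  fixes f g :: "'a \<Rightarrow> real ^ 'n ^ 'n"
  assumes "f \<in> borel_measurable M" "g \<in> borel_measurable M"
  shows "(\<lambda>x. f x ** g x) \<in> borel_measurable M"
  using assms by (rule borel_measurable_continuous_Pair) (intro continuous_intros)

lemma borel_measurable_det [measurable (raw)]:
  fixes f :: "'a \<Rightarrow> real ^ 'n ^ 'n"
  assumes "f \<in> borel_measurable M"
  shows "(\<lambda>x. det (f x)) \<in> borel_measurable M"
  by (rule borel_measurable_continuous_on[OF _ assms]) (intro continuous_intros)

lemma borel_measurable_sl_inv [measurable (raw)]: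
  fixes f :: "'a \<Rightarrow> real ^ 'n ^ 'n"
  assumes "f \<in> borel_measurable M"
  shows "(\<lambda>x. sl_inv (f x)) \<in> borel_measurable M"
  by (rule borel_measurable_continuous_on[OF _ assms]) (intro continuous_intros)

lemma borel_measurable_Umat [measurable (raw)]:
  fixes f :: "'a \<Rightarrow> real ^ 'k"
  assumes "f \<in> borel_measurable M"
  shows "(\<lambda>x. Umat e (f x) :: ('k::finite,'j::finite) mat) \<in> borel_measurable M"
  by (rule borel_measurable_continuous_on[OF _ assms]) (intro continuous_intros)

text \<open>Division by zero gives \<open>0\<close>, so \<open>svec\<close> is a Borel function on
  all matrices, although continuity is claimed only where the last entry is positive.\<close>

lemma borel_measurable_svec [measurable (raw)]:
  fixes f :: "'a \<Rightarrow> ('k::finite,'j::finite) mat"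
  assumes [measurable]: "f \<in> borel_measurable M"
  shows "(\<lambda>x. svec e (f x)) \<in> borel_measurable M"
  by (rule borel_measurable_vecI) (simp add: svec_def)

lemma borel_measurable_dpart [measurable (raw)]:
  fixes f :: "'a \<Rightarrow> ('k::finite,'j::finite) mat"
  assumes [measurable]: "f \<in> borel_measurable M"
  shows "(\<lambda>x. dpart e (f x)) \<in> borel_measurable M"
  unfolding dpart_def by measurable

lemma borel_DU:
  fixes D :: "('k::finite,'j::finite) mat set"
  assumes "D \<subseteq> HQ e" and [measurable]: "D \<in> sets borel" "A \<in> sets borel"
  shows "DU e D A \<in> sets borel"
proof -
  have "DU e D A = {g \<in> space borel. det g = 1 \<and> g $ Inr e $ Inr e > 0 \<and> dpart e g \<in> D \<and> svec e g \<in> A}"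
    using DU_iff[OF assms(1)] by auto
  also have "\<dots> \<in> sets borel" by measurable
  finally show ?thesis .
qed

section \<open>Lebesgue null sets under linear maps\<close>

lemma null_sets_linear_vimage:
  fixes f g :: "'a::euclidean_space \<Rightarrow> 'a"
  assumes N: "N \<in> null_sets lborel" and g: "linear g" and gf: "\<And>x. g (f x) = x"
    and f: "f \<in> borel_measurable borel"
  shows "{x. f x \<in> N} \<in> null_sets lborel"
proof -
  have "negligible N"
    using N by (simp add: negligible_iff_null_sets null_sets_completionI)
  then have "negligible (g ` N)"
    using g by (intro negligible_differentiable_image_negligible linear_imp_differentiable_on) auto
  moreover have "{x. f x \<in> N} \<subseteq> g ` N"
    using gf by (metis (mono_tags, lifting) imageI mem_Collect_eq subsetI)
  ultimately have "negligible {x. f x \<in> N}"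
    by (rule negligible_subset)
  moreover have "{x. f x \<in> N} \<in> sets lborel"
    using measurable_sets[OF f, of N] N by (auto simp: vimage_def)
  ultimately show ?thesis
    by (simp add: negligible_iff_null_sets null_sets_completion_iff)
qed

lemma null_sets_minus_vimage:
  fixes N :: "'a::euclidean_space set"
  assumes "N \<in> null_sets lborel"
  shows "{x. c - x \<in> N} \<in> null_sets lborel"
proof -
  have "{x. - x \<in> N} \<in> null_sets lborel"
    by (rule null_sets_linear_vimage[OF assms, where g = uminus]) (auto intro: linear_compose_neg linear_ident)
  then have "{x. x - c \<in> {x. - x \<in> N}} \<in> null_sets lborel"
    by (rule null_sets_translation)
  then show ?thesis by simp
qed

lemma null_sets_mult_vimage:
  fixes N :: "(real ^ 'n ^ 'n) set"
  assumes "N \<in> null_sets lborel" "det h = 1"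
  shows "{M. h ** M \<in> N} \<in> null_sets lborel"
proof (rule null_sets_linear_vimage[OF assms(1), where g = "\<lambda>M. sl_inv h ** M"])
  show "linear (\<lambda>M. sl_inv h ** M :: real ^ 'n ^ 'n)"
    by (rule linearI) (simp_all add: matrix_add_ldistrib matrix_scalar_ac scalar_matrix_assoc)
  show "(\<lambda>M :: real ^ 'n ^ 'n. h ** M) \<in> borel_measurable borel"
    by (rule borel_measurable_matrix_mult[OF borel_measurable_const measurable_ident_sets[OF refl]])
qed (use assms in simp)

text \<open>Fubini on the pairs \<open>(x, v)\<close> with \<open>P x - v\<close> in
  \<open>N\<close>. For fixed \<open>x\<close> the section in \<open>v\<close> is a reflected
  translate of \<open>N\<close>, hence null, so for some \<open>v\<close> the section in
  \<open>x\<close> is null as well. Translating by \<open>J v\<close> then removes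
  \<open>v\<close>.\<close>

lemma null_sets_projection_vimage:
  fixes P :: "'a::euclidean_space \<Rightarrow> 'b::euclidean_space" and J :: "'b \<Rightarrow> 'a"
  assumes P: "linear P" and PJ: "\<And>v. P (J v) = v" and N: "N \<in> null_sets lborel"
  shows "{x. P x \<in> N} \<in> null_sets lborel"
proof -
  have [measurable]: "P \<in> borel_measurable borel"
    using P by (intro borel_measurable_continuous_onI linear_continuous_on linear_conv_bounded_linear[THEN iffD1])
  have [measurable]: "N \<in> sets borel" using N by auto
  define Z where "Z = {z \<in> space (lborel \<Otimes>\<^sub>M lborel). P (fst z) - snd z \<in> N}"
  have Z: "Z \<in> sets (lborel \<Otimes>\<^sub>M lborel)" unfolding Z_def by measurable
  have "\<exists>v\<in>UNIV. emeasure lborel ((\<lambda>x. (x, v)) -` Z) = 0"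
  proof (rule fubini_null_ex[OF _ _ Z])
    have "Pair x -` Z = {v. P x - v \<in> N}" for x by (auto simp: Z_def space_pair_measure)
    then show "AE x in lborel. emeasure lborel (Pair x -` Z) = 0"
      using null_sets_minus_vimage[OF N] by (simp add: null_setsD1)
  qed (simp_all add: sigma_finite_lborel)
  then obtain v where v: "emeasure lborel {x. P x - v \<in> N} = 0"
    by (auto simp: Z_def space_pair_measure vimage_def)
  have "{x \<in> space borel. P x - v \<in> N} \<in> sets borel" by measurable
  with v have "{x. P x - v \<in> N} \<in> null_sets lborel" by auto
  then have "{x. x - (- J v) \<in> {x. P x - v \<in> N}} \<in> null_sets lborel"
    by (rule null_sets_translation)
  then show ?thesis
    by (simp add: linear_add[OF P] PJ)
qed

section \<open>Haar null sets on \<open>H\<close>\<close>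

lemma space_haar_H:
  assumes "haar_H e MH"
  shows "space MH = Hgrp e"
  using assms sets_eq_imp_space_eq[of MH "restrict_space borel (Hgrp e)"]
  by (simp add: haar_H_def space_restrict_space)

lemma sets_haar_H:
  assumes "haar_H e MH"
  shows "S \<in> sets MH \<longleftrightarrow> S \<subseteq> Hgrp e \<and> S \<in> sets borel"
proof -
  have "sets MH = sets (restrict_space borel (Hgrp e))"
    using assms by (simp add: haar_H_def)
  then show ?thesis
    by (simp add: sets_restrict_space_iff borel_closed closed_Hgrp)
qed

lemma haar_H_measurable_id:
  assumes "haar_H e MH"
  shows "(\<lambda>h. h) \<in> borel_measurable MH"
  using measurable_restrict_space1[OF measurable_ident, of borel "Hgrp e"] assms
  by (simp add: haar_H_def id_def cong: measurable_cong_sets)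

lemma haar_H_left_invariant:
  assumes "haar_H e MH" "h \<in> Hgrp e" "S \<in> sets MH"
  shows "emeasure MH ((**) h ` S) = emeasure MH S"
  using assms by (simp add: haar_H_def)

lemma sigma_finite_haar_H:
  fixes MH :: "('k::finite,'j::finite) mat measure"
  assumes "haar_H e MH"
  shows "sigma_finite_measure MH"
proof
  let ?A = "range (\<lambda>n. Hgrp e \<inter> cball (0 :: ('k,'j) mat) (real n))"
  have fin: "emeasure MH (Hgrp e \<inter> cball 0 (real n)) < \<infinity>" for n
    using assms closed_Int_compact[OF closed_Hgrp compact_cball, of e 0 "real n"]
    unfolding haar_H_def by blast
  then have "emeasure MH (Hgrp e \<inter> cball 0 (real n)) \<noteq> \<infinity>" for n
    using less_irrefl by metis
  moreover have "\<Union>?A = space MH"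
    by (auto simp: space_haar_H[OF assms] real_arch_simple)
  moreover have "?A \<subseteq> sets MH"
    by (auto simp: sets_haar_H[OF assms] closed_Hgrp intro!: borel_closed)
  ultimately show "\<exists>A. countable A \<and> A \<subseteq> sets MH \<and> \<Union>A = space MH \<and> (\<forall>a\<in>A. emeasure MH a \<noteq> \<infinity>)"
    by (intro exI[of _ ?A]) auto
qed

lemma emeasure_haar_H_pos:
  assumes "haar_H e MH"
  shows "emeasure MH (Hgrp e) \<noteq> 0"
proof -
  have "mat 1 \<in> Hgrp e"
    by (auto simp: Hgrp_iff vec_eq_iff mat_def axis_def det_I[unfolded mat_def])
  then show ?thesis
    using assms unfolding haar_H_def by (metis empty_iff less_irrefl openin_subtopology_self)
qed

text \<open>Fubini on \<open>{(x, y). x\<^sup>-\<^sup>1 y \<in> T}\<close>: the sections in \<open>y\<close> are the left translates \<open>xT\<close>, the sections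
  in \<open>x\<close> the left translates \<open>yT\<^sup>-\<^sup>1\<close>.\<close>
lemma haar_H_inverse_null:
  fixes MH :: "('k::finite,'j::finite) mat measure"
  assumes MH: "haar_H e MH" and T: "T \<in> null_sets MH"
  shows "{h \<in> Hgrp e. sl_inv h \<in> T} \<in> null_sets MH"
proof -
  note sets = sets_haar_H[OF MH] and space [simp] = space_haar_H[OF MH]
  note [measurable] = haar_H_measurable_id[OF MH]
  have TH: "T \<subseteq> Hgrp e" and [measurable]: "T \<in> sets borel" using T sets by auto
  let ?T' = "{h \<in> Hgrp e. sl_inv h \<in> T}"
  have "{h \<in> space MH. sl_inv h \<in> T} \<in> sets MH" by measurable
  then have T': "?T' \<in> sets MH" by simp
  define Z where "Z = {z \<in> space (MH \<Otimes>\<^sub>M MH). sl_inv (fst z) ** snd z \<in> T}"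
  have [measurable]: "fst \<in> borel_measurable (MH \<Otimes>\<^sub>M MH)" "snd \<in> borel_measurable (MH \<Otimes>\<^sub>M MH)"
    using measurable_compose[OF measurable_fst haar_H_measurable_id[OF MH]]
      measurable_compose[OF measurable_snd haar_H_measurable_id[OF MH]] by auto
  have Z: "Z \<in> sets (MH \<Otimes>\<^sub>M MH)" unfolding Z_def by measurable
  have "\<exists>y\<in>Hgrp e. emeasure MH ((\<lambda>x. (x, y)) -` Z) = 0"
  proof (rule fubini_null_ex[OF _ _ Z])
    show "AE x in MH. emeasure MH (Pair x -` Z) = 0"
    proof (rule AE_I2)
      fix x assume "x \<in> space MH"
      then have x: "x \<in> Hgrp e" by simp
      have "Pair x -` Z = (**) x ` T"
      proof (intro equalityI subsetI)
        fix y assume "y \<in> Pair x -` Z"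
        then show "y \<in> (**) x ` T"
          using x by (auto simp: Z_def Hgrp_iff intro!: image_eqI[of _ _ "sl_inv x ** y"])
      next
        fix y assume "y \<in> (**) x ` T"
        then show "y \<in> Pair x -` Z"
          using x TH Hgrp_mult[OF x] by (auto simp: Z_def space_pair_measure) (auto simp: Hgrp_iff)
      qed
      then show "emeasure MH (Pair x -` Z) = 0"
        using haar_H_left_invariant[OF MH x null_setsD2[OF T]] T by (simp add: null_setsD1)
    qed
    show "Hgrp e \<in> sets MH" by (simp add: sets borel_closed closed_Hgrp)
  qed (simp_all add: sigma_finite_haar_H[OF MH] emeasure_haar_H_pos[OF MH])
  then obtain y where y: "y \<in> Hgrp e" "emeasure MH ((\<lambda>x. (x, y)) -` Z) = 0" by blast
  have "(\<lambda>x. (x, y)) -` Z = (**) y ` ?T'"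
  proof (intro equalityI subsetI)
    fix x assume "x \<in> (\<lambda>x. (x, y)) -` Z"
    then have "x \<in> Hgrp e" "sl_inv x ** y \<in> T" by (auto simp: Z_def space_pair_measure)
    then show "x \<in> (**) y ` ?T'"
      using y(1) Hgrp_mult[OF Hgrp_inv[OF y(1)], of x]
      by (intro image_eqI[of _ _ "sl_inv y ** x"]) (simp_all add: Hgrp_iff sl_inv_mult)
  next
    fix x assume "x \<in> (**) y ` ?T'"
    then obtain u where u: "x = y ** u" "u \<in> Hgrp e" "sl_inv u \<in> T" by blast
    moreover from this have "sl_inv x ** y = sl_inv u"
      using y(1) by (simp add: Hgrp_iff sl_inv_mult)
    ultimately show "x \<in> (\<lambda>x. (x, y)) -` Z"
      using y(1) Hgrp_mult[OF y(1) u(2)] by (simp add: Z_def space_pair_measure)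
  qed
  then have "emeasure MH ?T' = 0"
    using haar_H_left_invariant[OF MH y(1) T'] y(2) by simp
  then show ?thesis using T' by auto
qed

text \<open>Inversion turns right translations into left ones: the set in question arises from
  \<open>T\<close> by inverting, translating on the left by \<open>h\<close> and inverting again,
  and each of these operations preserves null sets.\<close>

lemma haar_H_right_null:
  assumes MH: "haar_H e MH" and T: "T \<in> null_sets MH" and h: "h \<in> Hgrp e"
  shows "{h' \<in> Hgrp e. h' ** h \<in> T} \<in> null_sets MH"
proof -
  let ?T1 = "{u \<in> Hgrp e. sl_inv u \<in> T}"
  have T1: "?T1 \<in> null_sets MH" by (rule haar_H_inverse_null[OF MH T])
  have "(**) h ` ?T1 = {u \<in> Hgrp e. sl_inv h ** u \<in> ?T1}"
  proof (intro equalityI subsetI)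
    show "u \<in> {u \<in> Hgrp e. sl_inv h ** u \<in> ?T1}" if "u \<in> (**) h ` ?T1" for u
      using that h by (auto simp: Hgrp_mult) (auto simp: Hgrp_iff)
    show "u \<in> (**) h ` ?T1" if "u \<in> {u \<in> Hgrp e. sl_inv h ** u \<in> ?T1}" for u
      using that h by (auto simp: Hgrp_iff intro!: image_eqI[of _ _ "sl_inv h ** u"])
  qed
  moreover have "{u \<in> Hgrp e. sl_inv h ** u \<in> ?T1} \<in> sets MH"
    using borel_mult_vimage[of ?T1 "sl_inv h"] T1 sets_haar_H[OF MH] borel_closed[OF closed_Hgrp, of e]
      sets.Int[of "Hgrp e" borel "{u. sl_inv h ** u \<in> ?T1}"]
    by (auto simp: Int_def)
  ultimately have "(**) h ` ?T1 \<in> null_sets MH"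
    using haar_H_left_invariant[OF MH h null_setsD2[OF T1]] T1
    by (intro null_setsI) (simp_all only: null_setsD1)
  from haar_H_inverse_null[OF MH this]
  have "{u \<in> Hgrp e. sl_inv u \<in> (**) h ` ?T1} \<in> null_sets MH" .
  moreover have "sl_inv u \<in> (**) h ` ?T1 \<longleftrightarrow> u ** h \<in> T" if u: "u \<in> Hgrp e" for u
  proof
    assume "sl_inv u \<in> (**) h ` ?T1"
    then obtain t where t: "t \<in> ?T1" "sl_inv u = h ** t" by blast
    have "u = sl_inv (h ** t)"
      using u arg_cong[OF t(2), of sl_inv] by (simp add: Hgrp_iff)
    then have "u ** h = sl_inv t"
      using h t(1) by (simp add: Hgrp_iff sl_inv_mult)
    then show "u ** h \<in> T" using t(1) by simp
  next
    assume "u ** h \<in> T"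
    then have "sl_inv (u ** h) \<in> ?T1"
      using Hgrp_inv[OF Hgrp_mult[OF u h]] Hgrp_mult[OF u h] sl_inv_sl_inv[of "u ** h"]
      unfolding Hgrp_iff by simp
    moreover have "sl_inv u = h ** sl_inv (u ** h)"
      using u h by (simp add: Hgrp_iff sl_inv_mult)
    ultimately show "sl_inv u \<in> (**) h ` ?T1" by blast
  qed
  ultimately show ?thesis by (simp cong: conj_cong)
qed

lemma coset_null_if_translates_null:
  fixes mu :: "('k::finite,'j::finite) mat set measure" and f :: "'b \<Rightarrow> ('k,'j) mat"
  assumes mu: "haar_X mu" and Q: "sigma_finite_measure Q"
    and f [measurable]: "f \<in> borel_measurable Q"
    and B [measurable]: "B \<in> sets Q" and B0: "emeasure Q B \<noteq> 0"
    and det_f: "\<And>y. y \<in> B \<Longrightarrow> det (f y) = 1"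
    and S [measurable]: "S \<in> sets borel" and S_sub: "S \<subseteq> SLn"
    and null: "\<And>g. det g = 1 \<Longrightarrow> {y \<in> B. g ** f y \<in> S} \<in> null_sets Q"
  shows "coset ` S \<in> null_sets mu"
proof -
  have sets_mu: "sets mu = sets Xborel" and space_mu [simp]: "space mu = Xsp" and "prob_space mu"
    and inv: "\<And>g E. det g = 1 \<Longrightarrow> E \<in> sets mu \<Longrightarrow> measure mu ((\<lambda>x. Xact x g) ` E) = measure mu E"
    using mu by (auto simp: haar_X_def SLn_def)
  interpret prob_space mu by fact
  obtain \<sigma> :: "('k,'j) mat set \<Rightarrow> ('k,'j) mat"
    where \<sigma>: "\<sigma> \<in> borel_measurable Xborel" "\<And>x. x \<in> Xsp \<Longrightarrow> det (\<sigma> x) = 1 \<and> coset (\<sigma> x) = x"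
    using measurable_section by blast
  have [measurable]: "\<sigma> \<in> borel_measurable mu"
    using \<sigma>(1) sets_mu by (simp cong: measurable_cong_sets)
  define Z where "Z = {z \<in> space (mu \<Otimes>\<^sub>M Q). \<exists>\<gamma>\<in>Gamma. snd z \<in> B \<and> \<gamma> ** (\<sigma> (fst z) ** f (snd z)) \<in> S}"
  have Z: "Z \<in> sets (mu \<Otimes>\<^sub>M Q)"
    unfolding Z_def
  proof (rule sets.sets_Collect_countable_Ex'[OF _ countable_Gamma])
    fix \<gamma> :: "('k,'j) mat"
    show "{z \<in> space (mu \<Otimes>\<^sub>M Q). snd z \<in> B \<and> \<gamma> ** (\<sigma> (fst z) ** f (snd z)) \<in> S} \<in> sets (mu \<Otimes>\<^sub>M Q)"
      by measurable
  qed
  have BQ: "B \<subseteq> space Q" using B by (rule sets.sets_into_space)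
  have "\<exists>y\<in>B. emeasure mu ((\<lambda>x. (x, y)) -` Z) = 0"
  proof (rule fubini_null_ex[OF _ Q Z _ B B0])
    show "sigma_finite_measure mu" by (rule sigma_finite_measure_axioms)
    show "AE x in mu. emeasure Q (Pair x -` Z) = 0"
    proof (rule AE_I2)
      fix x assume "x \<in> space mu"
      then have x: "x \<in> Xsp" by simp
      have "Pair x -` Z = (\<Union>\<gamma>\<in>Gamma. {y \<in> B. (\<gamma> ** \<sigma> x) ** f y \<in> S})"
        using x BQ by (auto simp: Z_def space_pair_measure matrix_mul_assoc)
      also have "\<dots> \<in> null_sets Q"
        using \<sigma>(2)[OF x] by (intro null_sets_UN' countable_Gamma null) (simp add: det_mul GammaD)
      finally show "emeasure Q (Pair x -` Z) = 0" by (rule null_setsD1)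
    qed
  qed
  then obtain y where y: "y \<in> B" "emeasure mu ((\<lambda>x. (x, y)) -` Z) = 0" by blast
  have S': "coset ` S \<in> sets mu"
    using coset_image_Xborel[OF S S_sub] sets_mu by simp
  have "(\<lambda>x. (x, y)) -` Z = (\<lambda>x. Xact x (sl_inv (f y))) ` coset ` S"
  proof (intro equalityI subsetI)
    fix x assume "x \<in> (\<lambda>x. (x, y)) -` Z"
    then obtain \<gamma> where \<gamma>: "x \<in> Xsp" "\<gamma> \<in> Gamma" "\<gamma> ** (\<sigma> x ** f y) \<in> S"
      by (auto simp: Z_def space_pair_measure)
    have "Xact (coset (\<gamma> ** (\<sigma> x ** f y))) (sl_inv (f y)) = coset (\<gamma> ** \<sigma> x)"
      using det_f[OF y(1)] by (simp add: matrix_mul_assoc)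
    also have "\<dots> = x"
      using \<sigma>(2)[OF \<gamma>(1)] \<gamma>(2) coset_eq_iff by metis
    finally show "x \<in> (\<lambda>x. Xact x (sl_inv (f y))) ` coset ` S"
      using \<gamma>(3) by blast
  next
    fix x assume "x \<in> (\<lambda>x. Xact x (sl_inv (f y))) ` coset ` S"
    then obtain s where s: "s \<in> S" "x = coset (s ** sl_inv (f y))" by auto
    then have x: "x \<in> Xsp"
      using S_sub det_f[OF y(1)] by (auto simp: det_mul SLn_def)
    then obtain \<gamma> where \<gamma>: "\<gamma> \<in> Gamma" "s ** sl_inv (f y) = \<gamma> ** \<sigma> x"
      using s(2) \<sigma>(2)[OF x] by (metis coset_eq_iff)
    have "\<gamma> ** (\<sigma> x ** f y) = s"
      unfolding matrix_mul_assoc \<gamma>(2)[symmetric] using det_f[OF y(1)] by simp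
    then show "x \<in> (\<lambda>x. (x, y)) -` Z"
      using x y(1) BQ \<gamma>(1) s(1) by (auto simp: Z_def space_pair_measure)
  qed
  then have "measure mu (coset ` S) = 0"
    using inv[OF det_sl_inv[OF det_f[OF y(1)]] S'] y(2) by (simp add: measure_def)
  then show ?thesis
    using S' by (simp add: emeasure_eq_measure null_setsI)
qed

text \<open>Right multiplication by \<open>Umat e y\<close> shifts \<open>svec\<close> by
  \<open>- y\<close>, so for fixed \<open>g\<close> the parameters leading into the set lie in the
  reflected translate \<open>svec e g - A\<close>.\<close>

lemma coset_DU_null:
  fixes mu :: "('k::finite,'j::finite) mat set measure"
  assumes mu: "haar_X mu" and D: "D \<subseteq> HQ e" "D \<in> sets borel" and A: "A \<in> null_sets lborel"
  shows "coset ` DU e D A \<in> null_sets mu"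
proof (rule coset_null_if_translates_null[OF mu sigma_finite_lborel, where f = "Umat e" and B = UNIV])
  show "(Umat e :: real ^ 'k \<Rightarrow> ('k,'j) mat) \<in> borel_measurable lborel"
    using borel_measurable_Umat[of "\<lambda>s. s" borel] by simp
  show "DU e D A \<in> sets borel"
    using D A by (intro borel_DU) auto
  show "DU e D A \<subseteq> SLn"
    using DU_iff[OF D(1)] by (auto simp: SLn_def)
  fix g :: "('k,'j) mat" assume g: "det g = 1"
  show "{y \<in> UNIV. g ** Umat e y \<in> DU e D A} \<in> null_sets lborel"
  proof (rule null_sets_subset)
    show "{y. svec e g - y \<in> A} \<in> null_sets lborel"
      by (rule null_sets_minus_vimage[OF A])
    show "{y \<in> UNIV. g ** Umat e y \<in> DU e D A} \<in> sets lborel"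
    proof -
      have [measurable]: "DU e D A \<in> sets borel" by fact
      have "{y \<in> space borel. g ** Umat e y \<in> DU e D A} \<in> sets borel" by measurable
      then show ?thesis by simp
    qed
    show "{y \<in> UNIV. g ** Umat e y \<in> DU e D A} \<subseteq> {y. svec e g - y \<in> A}"
      using DU_iff[OF D(1)] by (auto simp: mult_Umat svec_mult_Umat)
  qed
qed simp_all

text \<open>The determinant is normalised by rescaling a single column among the first \<open>k\<close> (\<open>undefined\<close> is
  an arbitrary index). Unlike rescaling rows this commutes with left multiplication, and unlike rescaling the whole
  matrix it leaves \<open>wpart\<close> unchanged.\<close>
definition colscale :: "real \<Rightarrow> ('k::finite,'j::finite) mat" where
  "colscale c = (\<chi> p q. if p = q then (if p = Inl undefined then inverse c else 1) else 0)"

definition unimod :: "('k::finite,'j::finite) mat \<Rightarrow> ('k,'j) mat" where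
  "unimod M = M ** colscale (det M)"

lemma det_colscale: "det (colscale c :: ('k::finite,'j::finite) mat) = inverse c"
proof -
  have "det (colscale c :: ('k,'j) mat) = (\<Prod>p\<in>UNIV. (colscale c :: ('k,'j) mat) $ p $ p)"
    by (rule det_diagonal) (simp add: colscale_def)
  then show ?thesis by (simp add: colscale_def)
qed

lemma det_unimod: "det M \<noteq> 0 \<Longrightarrow> det (unimod M) = 1"
  by (simp add: unimod_def det_mul det_colscale)

lemma unimod_mult: "det g = 1 \<Longrightarrow> unimod (g ** M) = g ** unimod M"
  by (simp add: unimod_def det_mul matrix_mul_assoc)

lemma unimod_Inr: "unimod M $ p $ Inr i = M $ p $ Inr i"
proof -
  have "unimod M $ p $ Inr i = (\<Sum>l\<in>UNIV. if l = Inr i then M $ p $ l else 0)"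
    unfolding unimod_def matrix_matrix_mult_def vec_lambda_beta
    by (rule sum.cong) (auto simp: colscale_def)
  then show ?thesis by simp
qed

lemma borel_measurable_unimod [measurable (raw)]:
  fixes f :: "'a \<Rightarrow> ('k::finite,'j::finite) mat"
  assumes [measurable]: "f \<in> borel_measurable M"
  shows "(\<lambda>x. unimod (f x)) \<in> borel_measurable M"
proof -
  have "(\<lambda>x. (colscale (det (f x)) :: ('k,'j) mat) $ p $ q) \<in> borel_measurable M" for p q
    unfolding colscale_def by simp measurable
  then have [measurable]: "(\<lambda>x. colscale (det (f x)) :: ('k,'j) mat) \<in> borel_measurable M"
    by (intro borel_measurable_vecI)
  show ?thesis unfolding unimod_def by measurable
qed

text \<open>Translate by \<open>unimod M\<close>, with \<open>M\<close> Lebesgue-distributed on the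
  nonempty open set of invertible matrices. Since \<open>unimod\<close> commutes with left
  multiplication by \<open>g\<close>, the bad parameters are the preimage of the cone over
  \<open>S\<close> under \<open>M \<mapsto> g ** M\<close>, and that preimage is again null.\<close>

lemma coset_null_if_cone_null:
  fixes mu :: "('k::finite,'j::finite) mat set measure"
  assumes mu: "haar_X mu" and S: "S \<in> sets borel" "S \<subseteq> SLn"
    and null: "{M. det M \<noteq> 0 \<and> unimod M \<in> S} \<in> null_sets lborel"
  shows "coset ` S \<in> null_sets mu"
proof (rule coset_null_if_translates_null[OF mu sigma_finite_lborel, where f = unimod and B = "{M. det M \<noteq> 0}"])
  show "(unimod :: ('k,'j) mat \<Rightarrow> _) \<in> borel_measurable lborel"
    using borel_measurable_unimod[of "\<lambda>M. M" borel] by simp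
  have op: "open {M :: ('k,'j) mat. det M \<noteq> 0}"
    by (intro open_Collect_neq continuous_intros)
  then show "{M :: ('k,'j) mat. det M \<noteq> 0} \<in> sets lborel" by simp
  have "(mat 1 :: ('k,'j) mat) \<in> {M. det M \<noteq> 0}" by simp
  with op have "\<not> negligible {M :: ('k,'j) mat. det M \<noteq> 0}"
    using open_not_negligible by blast
  then show "emeasure lborel {M :: ('k,'j) mat. det M \<noteq> 0} \<noteq> 0"
    using op by (auto simp: negligible_iff_null_sets null_sets_completion_iff null_sets_def)
  fix g :: "('k,'j) mat" assume g: "det g = 1"
  have "{y \<in> {M. det M \<noteq> 0}. g ** unimod y \<in> S} = {M. g ** M \<in> {M. det M \<noteq> 0 \<and> unimod M \<in> S}}"
    using g by (auto simp: det_mul unimod_mult)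
  also have "\<dots> \<in> null_sets lborel"
    by (rule null_sets_mult_vimage[OF null g])
  finally show "{y \<in> {M. det M \<noteq> 0}. g ** unimod y \<in> S} \<in> null_sets lborel" .
qed (use S det_unimod in auto)

lemma AE_wpart:
  assumes "AE w in lborel. P w"
  shows "AE M in lborel. P (wpart e (M :: ('k::finite,'j::finite) mat))"
proof -
  obtain N where N: "N \<in> null_sets lborel" "\<forall>w. w \<notin> N \<longrightarrow> P w"
    using assms by (auto elim!: AE_E3)
  \<comment> \<open>Writing \<open>v\<close> into the last row gives a right inverse of the linear
    map \<open>wpart e\<close>.\<close>
  define J :: "real ^ 'j \<Rightarrow> ('k,'j) mat" where
    "J v = (\<chi> p q. if p = Inr e then (case q of Inl a \<Rightarrow> 0 | Inr i \<Rightarrow> v $ i) else 0)" for v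
  have "linear (wpart e :: ('k,'j) mat \<Rightarrow> _)"
    by (rule linearI) (simp_all add: wpart_def vec_eq_iff)
  moreover have "wpart e (J v) = v" for v
    by (simp add: wpart_def J_def)
  ultimately have "{M :: ('k,'j) mat. wpart e M \<in> N} \<in> null_sets lborel"
    using N(1) by (rule null_sets_projection_vimage)
  then show ?thesis
    by (rule AE_I') (use N(2) in auto)
qed

lemma dpart_Hgrp_mult:
  assumes "h \<in> Hgrp e"
  shows "dpart e (h ** g) = h ** dpart e g"
  using Hgrp_mult_row[OF assms, of g] by (simp add: dpart_def svec_def matrix_mul_assoc)

text \<open>Fubini on the pairs \<open>(M, h)\<close> with \<open>h ** M\<close> in the cone. In the
  main case the \<open>HQ\<close> part of \<open>unimod M\<close> is \<open>h0 ** Rmat e w\<close>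
  with \<open>w = wpart e M\<close>, so the section in \<open>h\<close> is a right translate by
  \<open>h0\<close> of the slice at \<open>w\<close> of the null set defining
  \<open>nu_null\<close>. Almost every slice is null, and \<open>wpart\<close> pulls this back to
  almost every \<open>M\<close>. A single good \<open>h\<close> then gives a null left translate of
  the cone.\<close>

lemma nu_null_imp_cone_null:
  fixes MH :: "('k::finite,'j::finite) mat measure"
  assumes MH: "haar_H e MH" and C: "C \<subseteq> HQ e" "C \<in> sets borel" and nu: "nu_null e MH C"
  shows "{M. det M \<noteq> 0 \<and> unimod M \<in> DU e C UNIV} \<in> null_sets lborel" (is "?Z \<in> _")
proof -
  note space [simp] = space_haar_H[OF MH]
  interpret H: sigma_finite_measure MH by (rule sigma_finite_haar_H[OF MH])
  interpret pair_sigma_finite MH "lborel :: (real ^ 'j) measure"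
    by (intro pair_sigma_finite.intro sigma_finite_lborel) unfold_locales
  define T where "T = {(h, w). h \<in> Hgrp e \<and> w \<in> Wpos e \<and> h ** Rmat e w \<in> C}"
  have T: "T \<in> null_sets (MH \<Otimes>\<^sub>M lborel)"
    using nu by (simp add: nu_null_def T_def)
  then have "(\<integral>\<^sup>+w. emeasure MH ((\<lambda>h. (h, w)) -` T) \<partial>lborel) = 0"
    using emeasure_pair_measure_alt2[OF null_setsD2[OF T]] null_setsD1[OF T] by simp
  then have "AE w in lborel. emeasure MH ((\<lambda>h. (h, w)) -` T) = 0"
    using measurable_emeasure_Pair2[OF null_setsD2[OF T]] by (subst (asm) nn_integral_0_iff_AE) auto
  moreover have "(\<lambda>h. (h, w)) -` T \<in> sets MH" for w
    using T by (intro sets_Pair2) auto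
  ultimately have "AE w in lborel. (\<lambda>h. (h, w)) -` T \<in> null_sets MH"
    by (simp add: null_sets_def)
  from AE_wpart[OF this]
  have good: "AE M in lborel. (\<lambda>h. (h, wpart e (M :: ('k,'j) mat))) -` T \<in> null_sets MH" .
  have DU [measurable]: "DU e C UNIV \<in> sets borel"
    using C by (intro borel_DU) auto
  have "{M \<in> space borel. det M \<noteq> 0 \<and> unimod M \<in> DU e C UNIV} \<in> sets borel" by measurable
  then have Z_borel [measurable]: "?Z \<in> sets borel" by simp
  \<comment> \<open>Left multiplication by \<open>h\<close> preserves the determinant and the last
    row and acts on the \<open>HQ\<close> part by left multiplication.\<close>
  have Z_iff: "h ** M \<in> ?Z \<longleftrightarrow> det M \<noteq> 0 \<and> M $ Inr e $ Inr e > 0 \<and> h ** dpart e (unimod M) \<in> C"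
    if h: "h \<in> Hgrp e" for h M
  proof -
    have "det h = 1" using h by (simp add: Hgrp_iff)
    then show ?thesis
      using h det_unimod[of M]
      by (auto simp: DU_iff[OF C(1)] det_mul unimod_mult dpart_Hgrp_mult Hgrp_mult_row unimod_Inr)
  qed
  define P where "P = {z \<in> space (lborel \<Otimes>\<^sub>M MH). snd z ** fst z \<in> ?Z}"
  have [measurable]: "snd \<in> borel_measurable (lborel \<Otimes>\<^sub>M MH)"
    using measurable_compose[OF measurable_snd haar_H_measurable_id[OF MH]] by auto
  have P: "P \<in> sets (lborel \<Otimes>\<^sub>M MH)"
    unfolding P_def by measurable
  have "\<exists>h\<in>Hgrp e. emeasure lborel ((\<lambda>M. (M, h)) -` P) = 0"
  proof (rule fubini_null_ex[OF sigma_finite_lborel H.sigma_finite_measure_axioms P])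
    show "Hgrp e \<in> sets MH" using sets.top[of MH] by simp
    show "emeasure MH (Hgrp e) \<noteq> 0" by (rule emeasure_haar_H_pos[OF MH])
    show "AE M in lborel. emeasure MH (Pair M -` P) = 0"
      using good
    proof (rule eventually_mono)
      fix M :: "('k,'j) mat"
      assume null: "(\<lambda>h. (h, wpart e M)) -` T \<in> null_sets MH"
      have PM: "Pair M -` P = {h \<in> Hgrp e. h ** M \<in> ?Z}"
        by (auto simp: P_def space_pair_measure)
      show "emeasure MH (Pair M -` P) = 0"
      proof (cases "det M \<noteq> 0 \<and> M $ Inr e $ Inr e > 0")
        case True
        define d where "d = dpart e (unimod M)"
        have d: "d \<in> HQ e"
          unfolding d_def using True by (intro dpart_in_HQ) (simp_all add: det_unimod unimod_Inr)
        \<comment> \<open>Neither the column rescaling in \<open>unimod\<close> nor the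
          multiplication by \<open>Umat\<close> in \<open>dpart\<close> changes the last
          \<open>m+1\<close> columns.\<close>
        have w: "wpart e d = wpart e M"
          by (simp add: wpart_def d_def dpart_def mult_Umat unimod_Inr)
        obtain h where h: "h \<in> Hgrp e" "d = h ** Rmat e (wpart e M)" and W: "wpart e M \<in> Wpos e"
          using HQ_decomp[of d e] d w unfolding HQ_iff by auto
        have "Pair M -` P = {h' \<in> Hgrp e. h' ** h \<in> (\<lambda>h. (h, wpart e M)) -` T}"
        proof -
          have "h' ** M \<in> ?Z \<longleftrightarrow> h' ** h \<in> (\<lambda>h. (h, wpart e M)) -` T" if h': "h' \<in> Hgrp e" for h'
            unfolding Z_iff[OF h'] d_def[symmetric] h(2)
            using True W Hgrp_mult[OF h' h(1)] by (simp add: T_def matrix_mul_assoc)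
          then show ?thesis unfolding PM by blast
        qed
        then show ?thesis
          using haar_H_right_null[OF MH null h(1)] by (simp add: null_setsD1)
      next
        case False
        then have "Pair M -` P = {}" unfolding PM by (auto simp: Z_iff simp del: mem_Collect_eq)
        then show ?thesis by simp
      qed
    qed
  qed
  then obtain h where h: "h \<in> Hgrp e" "emeasure lborel ((\<lambda>M. (M, h)) -` P) = 0" by blast
  moreover have "(\<lambda>M. (M, h)) -` P = {M. h ** M \<in> ?Z}"
    using h(1) by (auto simp: P_def space_pair_measure)
  ultimately have "{M. h ** M \<in> ?Z} \<in> null_sets lborel"
    using borel_mult_vimage[OF Z_borel, of h] by (intro null_setsI) simp_all
  \<comment> \<open>Left multiplication by the inverse of \<open>h\<close> carries the null
    translate back to the cone itself.\<close>
  from null_sets_mult_vimage[OF this, of "sl_inv h"] show ?thesis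
    using h(1) by (simp add: Hgrp_iff)
qed

section \<open>Hit counts\<close>

lemma Sigma1_subset_HQ:
  assumes "F \<subseteq> Hgrp e" "W \<subseteq> Wpos e"
  shows "Sigma1 e F W \<subseteq> HQ e"
  using assms by (auto simp: Sigma1_def HQ_def)

text \<open>A hit \<open>(s, d)\<close> at \<open>\<Gamma>g\<close> means
  \<open>d = \<gamma> ** g ** Umat e s\<close> for some \<open>\<gamma>\<close> in
  \<open>Gamma\<close>, so it determines \<open>\<gamma>\<close>. Conversely \<open>s\<close> and
  \<open>d\<close> are the coordinates \<open>svec\<close> and \<open>dpart\<close> of
  \<open>\<gamma> ** g\<close>.\<close>

lemma bij_betw_hits:
  fixes g :: "('k::finite,'j::finite) mat"
  assumes g: "det g = 1" and D: "D \<subseteq> Sigma1 e F W" "D \<subseteq> HQ e"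
  shows "bij_betw (\<lambda>(s, d). d ** Umat e (- s) ** sl_inv g) (hits e F W (coset g) A D)
    {\<gamma> \<in> Gamma. \<gamma> ** g \<in> DU e D A}"
proof -
  let ?f = "\<lambda>(s, d). d ** Umat e (- s) ** sl_inv g"
  let ?f' = "\<lambda>\<gamma>. (svec e (\<gamma> ** g), dpart e (\<gamma> ** g))"
  have hit: "?f (s, d) ** g = d ** Umat e (- s)" "?f (s, d) \<in> Gamma" "d \<in> HQ e" "d \<in> D" "s \<in> A"
    if sd: "(s, d) \<in> hits e F W (coset g) A D" for s d
  proof -
    show "?f (s, d) ** g = d ** Umat e (- s)" using g by simp
    have "coset d = coset (g ** Umat e s)" using sd by (simp add: hits_def)
    then obtain \<gamma> where \<gamma>: "\<gamma> \<in> Gamma" "d = \<gamma> ** (g ** Umat e s)"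
      by (auto simp: coset_eq_iff)
    then have "?f (s, d) = \<gamma>"
      using g by (simp add: matrix_mul_assoc)
    then show "?f (s, d) \<in> Gamma" using \<gamma>(1) by simp
    show "d \<in> HQ e" "d \<in> D" "s \<in> A" using sd D by (auto simp: hits_def)
  qed
  show ?thesis
  proof (rule bij_betw_byWitness[where f' = ?f'])
    show "\<forall>p\<in>hits e F W (coset g) A D. ?f' (?f p) = p"
    proof
      fix p assume p: "p \<in> hits e F W (coset g) A D"
      obtain s d where sd: "p = (s, d)" by (cases p)
      show "?f' (?f p) = p"
        using hit[OF p[unfolded sd]] HQ_Umat(1,2)[of d e s] unfolding sd by simp
    qed
    show "\<forall>\<gamma>\<in>{\<gamma> \<in> Gamma. \<gamma> ** g \<in> DU e D A}. ?f (?f' \<gamma>) = \<gamma>"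
      using g by (simp add: dpart_svec)
    show "?f ` hits e F W (coset g) A D \<subseteq> {\<gamma> \<in> Gamma. \<gamma> ** g \<in> DU e D A}"
    proof
      fix \<gamma> assume "\<gamma> \<in> ?f ` hits e F W (coset g) A D"
      then obtain p where p: "p \<in> hits e F W (coset g) A D" "\<gamma> = ?f p" by (rule imageE) simp
      moreover obtain s d where "p = (s, d)" by (cases p)
      ultimately have "(s, d) \<in> hits e F W (coset g) A D" "\<gamma> = ?f (s, d)" by simp_all
      then show "\<gamma> \<in> {\<gamma> \<in> Gamma. \<gamma> ** g \<in> DU e D A}"
        using hit[of s d] unfolding DU_def by blast
    qed
    show "?f' ` {\<gamma> \<in> Gamma. \<gamma> ** g \<in> DU e D A} \<subseteq> hits e F W (coset g) A D"
    proof clarify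
      fix \<gamma> assume \<gamma>: "\<gamma> \<in> Gamma" "\<gamma> ** g \<in> DU e D A"
      then have "dpart e (\<gamma> ** g) \<in> D" "svec e (\<gamma> ** g) \<in> A"
        using DU_iff[OF D(2)] by auto
      moreover have "dpart e (\<gamma> ** g) = \<gamma> ** (g ** Umat e (svec e (\<gamma> ** g)))"
        by (simp add: dpart_def matrix_mul_assoc)
      then have "coset (dpart e (\<gamma> ** g)) = coset (g ** Umat e (svec e (\<gamma> ** g)))"
        using \<gamma>(1) coset_eq_iff by blast
      ultimately show "?f' \<gamma> \<in> hits e F W (coset g) A D"
        using D by (auto simp: hits_def)
    qed
  qed
qed

text \<open>Removing the relative interior from the closure removes an ambient open set. Compactness
  makes the frontier relative to \<open>HQ\<close> closed in the whole matrix space, hence Borel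
  there.\<close>

lemma compact_frontier_of:
  fixes D :: "'a::t2_space set"
  assumes "compact (top_of_set S closure_of D)"
  shows "compact (top_of_set S frontier_of D)"
proof -
  obtain U where U: "open U" "top_of_set S interior_of D = S \<inter> U"
    using openin_interior_of[of "top_of_set S" D] unfolding openin_open by blast
  have "top_of_set S closure_of D \<subseteq> S"
    using closure_of_subset_topspace[of "top_of_set S" D] by simp
  then have "top_of_set S frontier_of D = top_of_set S closure_of D - U"
    using U(2) by (auto simp: frontier_of_def)
  then show ?thesis
    using compact_diff[OF assms U(1)] by simp
qed

text \<open>If \<open>g\<close> lies outside the compact set built from the two closures, a whole
  neighbourhood does. Otherwise avoiding both frontiers places the coordinates of \<open>g\<close>
  in the interiors, and these coordinates vary continuously.\<close>

lemma DU_locally_constant: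
  fixes g :: "('k::finite,'j::finite) mat"
  assumes D: "D \<subseteq> HQ e" "compact (top_of_set (HQ e) closure_of D)" and A: "bounded A" and g: "det g = 1"
    and g1: "g \<notin> DU e (top_of_set (HQ e) frontier_of D) UNIV"
    and g2: "g \<notin> DU e (top_of_set (HQ e) closure_of D) (frontier A)"
  shows "\<exists>V. open V \<and> g \<in> V \<and> (\<forall>v\<in>V. det v = 1 \<longrightarrow> (v \<in> DU e D A \<longleftrightarrow> g \<in> DU e D A))"
proof -
  let ?cl = "top_of_set (HQ e) closure_of D" and ?fr = "top_of_set (HQ e) frontier_of D"
  let ?in = "top_of_set (HQ e) interior_of D"
  have cl: "?cl \<subseteq> HQ e"
    using closure_of_subset_topspace[of "top_of_set (HQ e)" D] by simp
  have fr: "?fr \<subseteq> HQ e"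
    using cl by (auto simp: frontier_of_def)
  have Dcl: "D \<subseteq> ?cl"
    using D(1) by (intro closure_of_subset) simp
  have cA: "compact (closure A)" using A by simp
  show ?thesis
  proof (cases "g \<in> DU e ?cl (closure A)")
    case True
    then have pos: "g $ Inr e $ Inr e > 0" and "dpart e g \<in> ?cl" "svec e g \<in> closure A"
      using DU_iff[OF cl] by auto
    then have gin: "dpart e g \<in> ?in" "svec e g \<in> interior A"
      using g1 g2 g DU_iff[OF cl, of g "frontier A"] DU_iff[OF fr, of g UNIV]
      by (auto simp: frontier_of_def frontier_def)
    obtain U where U: "open U" "?in = HQ e \<inter> U"
      using openin_interior_of[of "top_of_set (HQ e)" D] unfolding openin_open by blast
    have UD: "HQ e \<inter> U \<subseteq> D"
      using interior_of_subset[of "top_of_set (HQ e)" D] U(2) by simp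
    let ?P = "{v :: ('k,'j) mat. v $ Inr e $ Inr e > 0}"
    have P: "open ?P" by (intro open_Collect_less continuous_intros)
    \<comment> \<open>This set is open among all matrices; only its points of determinant one have
      \<open>dpart\<close> in \<open>HQ\<close>, where \<open>U\<close> can be compared with
      \<open>D\<close>.\<close>
    let ?V = "(?P \<inter> dpart e -` U) \<inter> (?P \<inter> svec e -` interior A)"
    have "open ?V"
      by (intro open_Int continuous_open_preimage continuous_on_dpart continuous_on_svec P U(1) open_interior)
    moreover have "g \<in> ?V" using pos gin U(2) by auto
    moreover have "v \<in> DU e D A" if v: "v \<in> ?V" "det v = 1" for v
      using v dpart_in_HQ[OF v(2), of e] UD interior_subset[of A] by (auto simp: DU_iff[OF D(1)])
    ultimately show ?thesis using g by blast
  next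
    case False
    have "open (- DU e ?cl (closure A))"
      by (intro open_Compl compact_imp_closed compact_DU D(2) cA)
    moreover have "DU e D A \<subseteq> DU e ?cl (closure A)"
      by (intro DU_mono Dcl closure_subset)
    ultimately show ?thesis
      using False by (intro exI[of _ "- DU e ?cl (closure A)"]) blast
  qed
qed

text \<open>Each \<open>\<gamma>\<close> has its own neighbourhood of constancy. By discreteness
  only finitely many \<open>\<gamma>\<close> can produce a hit near \<open>g\<close>, so finitely
  many neighbourhoods have to be intersected.\<close>

lemma orbit_hits_locally_constant:
  fixes g :: "('k::finite,'j::finite) mat"
  assumes D: "D \<subseteq> HQ e" "compact (top_of_set (HQ e) closure_of D)" and A: "bounded A" and g: "det g = 1"
    and g1: "coset g \<notin> coset ` DU e (top_of_set (HQ e) frontier_of D) UNIV"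
    and g2: "coset g \<notin> coset ` DU e (top_of_set (HQ e) closure_of D) (frontier A)"
  shows "\<exists>V. open V \<and> g \<in> V \<and> (\<forall>v\<in>V. det v = 1 \<longrightarrow>
    {\<gamma> \<in> Gamma. \<gamma> ** v \<in> DU e D A} = {\<gamma> \<in> Gamma. \<gamma> ** g \<in> DU e D A})"
proof -
  let ?cl = "top_of_set (HQ e) closure_of D"
  have "\<exists>V. open V \<and> g \<in> V \<and> (\<forall>v\<in>V. det v = 1 \<longrightarrow> (\<gamma> ** v \<in> DU e D A \<longleftrightarrow> \<gamma> ** g \<in> DU e D A))"
    if \<gamma>: "\<gamma> \<in> Gamma" for \<gamma>
  proof -
    have "\<gamma> ** g \<notin> DU e (top_of_set (HQ e) frontier_of D) UNIV" "\<gamma> ** g \<notin> DU e ?cl (frontier A)"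
      using g1 g2 \<gamma> by (auto simp: coset_image_iff[OF g])
    then obtain V where V: "open V" "\<gamma> ** g \<in> V"
        "\<forall>v\<in>V. det v = 1 \<longrightarrow> (v \<in> DU e D A \<longleftrightarrow> \<gamma> ** g \<in> DU e D A)"
      using DU_locally_constant[OF D A, of "\<gamma> ** g"] g GammaD[OF \<gamma>] by (auto simp: det_mul)
    have "open ((\<lambda>v. \<gamma> ** v) -` V)"
      using V(1) by (intro open_vimage continuous_intros)
    then show ?thesis
      using V GammaD[OF \<gamma>] by (intro exI[of _ "(\<lambda>v. \<gamma> ** v) -` V"]) (auto simp: det_mul)
  qed
  then obtain V where V: "\<And>\<gamma>. \<gamma> \<in> Gamma \<Longrightarrow> open (V \<gamma>) \<and> g \<in> V \<gamma> \<and>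
      (\<forall>v\<in>V \<gamma>. det v = 1 \<longrightarrow> (\<gamma> ** v \<in> DU e D A \<longleftrightarrow> \<gamma> ** g \<in> DU e D A))"
    by metis
  \<comment> \<open>The radius \<open>1\<close> is arbitrary; it cuts out a compact piece of
    \<open>SLn\<close> around \<open>g\<close>. For \<open>\<gamma>\<close> outside \<open>I\<close>
    there is no hit at \<open>g\<close> or at any point of that piece.\<close>
  define I where "I = {\<gamma> \<in> Gamma. \<exists>v\<in>SLn \<inter> cball g 1. \<gamma> ** v \<in> DU e ?cl (closure A)}"
  have "finite I"
    unfolding I_def using D(2) A
    by (intro finite_Gamma_meets closed_Int_compact closed_SLn compact_DU) auto
  define U where "U = ball g 1 \<inter> (\<Inter>\<gamma>\<in>I. V \<gamma>)"
  have "open U"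
    unfolding U_def using \<open>finite I\<close> V by (intro open_Int open_INT) (auto simp: I_def)
  moreover have "g \<in> U"
    using V by (auto simp: U_def I_def)
  moreover have "\<gamma> ** v \<in> DU e D A \<longleftrightarrow> \<gamma> ** g \<in> DU e D A" if v: "v \<in> U" "det v = 1" and \<gamma>: "\<gamma> \<in> Gamma" for v \<gamma>
  proof (cases "\<gamma> \<in> I")
    case True
    then show ?thesis using V[OF \<gamma>] v by (auto simp: U_def)
  next
    case False
    have "DU e D A \<subseteq> DU e ?cl (closure A)"
      using D(1) by (intro DU_mono closure_of_subset closure_subset) simp
    moreover have "v \<in> SLn \<inter> cball g 1" "g \<in> SLn \<inter> cball g 1"
      using v g by (auto simp: U_def SLn_def)
    ultimately show ?thesis
      using False \<gamma> unfolding I_def by blast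
  qed
  ultimately show ?thesis by blast
qed

text \<open>The image of \<open>V\<close> in the quotient is an open neighbourhood of
  \<open>coset g\<close>, and it lies inside \<open>E\<close> or misses \<open>E\<close>.\<close>

lemma not_in_Xbd:
  fixes E :: "('k::finite,'j::finite) mat set set"
  assumes "det g = 1" "open V" "g \<in> V" "\<And>v. v \<in> V \<Longrightarrow> det v = 1 \<Longrightarrow> coset v \<in> E \<longleftrightarrow> coset g \<in> E"
  shows "coset g \<notin> Xbd E"
proof -
  have op: "openin Xtop (coset ` (SLn \<inter> V))"
    using assms(2) by (intro openin_coset_image openin_open_Int)
  have mem: "coset g \<in> coset ` (SLn \<inter> V)"
    using assms by (auto simp: SLn_def)
  show ?thesis
  proof (cases "coset g \<in> E")
    case True
    then have "coset ` (SLn \<inter> V) \<subseteq> E" using assms(4) by (auto simp: SLn_def)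
    then have "coset g \<in> Xtop interior_of E"
      using op mem interior_of_maximal by blast
    then show ?thesis by (simp add: Xbd_def frontier_of_def)
  next
    case False
    have "coset ` (SLn \<inter> V) \<inter> E = {}" using False assms(4) by (auto simp: SLn_def)
    have "coset g \<notin> Xtop closure_of E"
    proof
      assume "coset g \<in> Xtop closure_of E"
      then have "\<exists>y. y \<in> E \<and> y \<in> coset ` (SLn \<inter> V)"
        unfolding in_closure_of using op mem by (elim conjE allE[of _ "coset ` (SLn \<inter> V)"]) simp
      with \<open>coset ` (SLn \<inter> V) \<inter> E = {}\<close> show False by blast
    qed
    then show ?thesis by (simp add: Xbd_def frontier_of_def)
  qed
qed

theorem theorem3:
  fixes e :: "'j::finite"
    and F :: "('k::finite, 'j) mat set"
    and W :: "(real ^ 'j) set"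
    and mu lam :: "('k, 'j) mat set measure"
    and MH :: "('k, 'j) mat measure"
    and r :: nat
    and A :: "nat \<Rightarrow> (real ^ 'k) set"
    and D :: "nat \<Rightarrow> ('k, 'j) mat set"
    and N :: "nat \<Rightarrow> nat"
  assumes mu: "haar_X mu"
    and lam: "admissible e mu lam"
    and MH: "haar_H e MH"
    and F: "fund_dom_H e F"
    and W_sub: "W \<subseteq> Wpos e" and W_bdd: "bounded W" and W_borel: "W \<in> sets borel"
    and W_int: "interior W \<noteq> {}" and W_bd: "frontier W \<in> null_sets lborel"
    and A_borel: "\<And>i. i < r \<Longrightarrow> A i \<in> sets borel"
    and A_bdd: "\<And>i. i < r \<Longrightarrow> bounded (A i)"
    and A_bd: "\<And>i. i < r \<Longrightarrow> frontier (A i) \<in> null_sets lborel"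
    and D_sub: "\<And>i. i < r \<Longrightarrow> D i \<subseteq> Sigma1 e F W"
    and D_borel: "\<And>i. i < r \<Longrightarrow> D i \<in> sets borel"
    and D_cpt: "\<And>i. i < r \<Longrightarrow> compact (top_of_set (HQ e) closure_of D i)"
    and D_bd: "\<And>i. i < r \<Longrightarrow> nu_null e MH (top_of_set (HQ e) frontier_of D i)"
  shows "((\<lambda>L. measure lam {x \<in> Xsp. \<forall>i<r.
              finite (hits_L e F W L x (A i) (D i)) \<and> card (hits_L e F W L x (A i) (D i)) = N i})
          \<longlongrightarrow> measure mu {x \<in> Xsp. \<forall>i<r.
              finite (hits e F W x (A i) (D i)) \<and> card (hits e F W x (A i) (D i)) = N i}) at_top
         \<and> measure mu {x \<in> Xsp. \<forall>i<r.
              finite (hits e F W x (A i) (D i)) \<and> card (hits e F W x (A i) (D i)) = N i}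
           = measure mu {coset g | g. g \<in> SLn \<and> (\<forall>i<r.
              finite {gam \<in> Gamma. gam ** g \<in> {d ** Umat e (- a) | d a. d \<in> D i \<and> a \<in> A i}}
              \<and> card {gam \<in> Gamma. gam ** g \<in> {d ** Umat e (- a) | d a. d \<in> D i \<and> a \<in> A i}} = N i)}"
proof -
  define E where "E = {x \<in> Xsp. \<forall>i<r. finite (hits e F W x (A i) (D i)) \<and> card (hits e F W x (A i) (D i)) = N i}"
  let ?cnt = "\<lambda>g i. {\<gamma> \<in> Gamma. \<gamma> ** g \<in> DU e (D i) (A i)}"
  let ?cl = "\<lambda>i. top_of_set (HQ e) closure_of D i" and ?fr = "\<lambda>i. top_of_set (HQ e) frontier_of D i"
  have D_HQ: "D i \<subseteq> HQ e" if "i < r" for i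
    using D_sub[OF that] Sigma1_subset_HQ[OF _ W_sub, of F] F by (auto simp: fund_dom_H_def)
  \<comment> \<open>The bijection with hits turns \<open>E\<close> into a condition on the
    representative \<open>g\<close> alone, independent of the fundamental domain
    \<open>F\<close>.\<close>
  have E_iff: "coset g \<in> E \<longleftrightarrow> (\<forall>i<r. finite (?cnt g i) \<and> card (?cnt g i) = N i)" if g: "det g = 1" for g
  proof -
    have "finite (hits e F W (coset g) (A i) (D i)) = finite (?cnt g i)"
      "card (hits e F W (coset g) (A i) (D i)) = card (?cnt g i)" if "i < r" for i
      using bij_betw_hits[OF g D_sub[OF that] D_HQ[OF that], of "A i"]
        bij_betw_finite bij_betw_same_card by blast+
    then show ?thesis
      using g by (simp add: E_def)
  qed
  have E_sub: "E \<subseteq> Xsp" by (auto simp: E_def)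
  have "E \<in> sets Xborel"
  proof (rule Xborel_from_preimage[OF E_sub])
    have "{g \<in> SLn. coset g \<in> E}
        = SLn \<inter> {g \<in> space borel. \<forall>i\<in>{..<r}. finite (?cnt g i) \<and> card (?cnt g i) = N i}"
      using E_iff by (auto simp: SLn_def)
    also have "\<dots> \<in> sets borel"
    proof (intro sets.Int borel_closed[OF closed_SLn] sets.sets_Collect_finite_All measurable_card_eq countable_Gamma)
      fix i and \<gamma> :: "('k,'j) mat" assume "i \<in> {..<r}"
      then have "DU e (D i) (A i) \<in> sets borel"
        using D_HQ D_borel A_borel by (intro borel_DU) auto
      from borel_mult_vimage[OF this, of \<gamma>]
      show "{g \<in> space borel. \<gamma> ** g \<in> DU e (D i) (A i)} \<in> sets borel" by simp
    qed simp
    finally show "{g \<in> SLn. coset g \<in> E} \<in> sets borel" .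
  qed
  moreover have "measure mu (Xbd E) = 0"
  proof -
    have sets_mu: "sets mu = sets Xborel" using mu by (simp add: haar_X_def)
    let ?S1 = "\<lambda>i. coset ` DU e (?fr i) UNIV" and ?S2 = "\<lambda>i. coset ` DU e (?cl i) (frontier (A i))"
    \<comment> \<open>\<open>?S1 i\<close> consists of the points with a lattice translate over the
      frontier of \<open>D i\<close> at any hitting time, \<open>?S2 i\<close> of those with one
      whose hitting time lies on the frontier of \<open>A i\<close>.\<close>
    have "(\<Union>i\<in>{..<r}. ?S1 i \<union> ?S2 i) \<in> null_sets mu"
    proof (intro null_sets_UN' null_sets.Un)
      fix i assume "i \<in> {..<r}"
      then have i: "i < r" by simp
      have cl: "?cl i \<subseteq> HQ e"
        using closure_of_subset_topspace[of "top_of_set (HQ e)" "D i"] by simp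
      then have fr: "?fr i \<subseteq> HQ e" by (auto simp: frontier_of_def)
      have frb: "?fr i \<in> sets borel"
        using compact_frontier_of[OF D_cpt[OF i]] by (intro borel_closed compact_imp_closed)
      have clb: "?cl i \<in> sets borel"
        using D_cpt[OF i] by (intro borel_closed compact_imp_closed)
      show "?S1 i \<in> null_sets mu"
      proof (rule coset_null_if_cone_null[OF mu])
        show "DU e (?fr i) UNIV \<in> sets borel" using fr frb by (intro borel_DU) auto
        show "DU e (?fr i) UNIV \<subseteq> SLn" using DU_iff[OF fr] by (auto simp: SLn_def)
        show "{M. det M \<noteq> 0 \<and> unimod M \<in> DU e (?fr i) UNIV} \<in> null_sets lborel"
          by (rule nu_null_imp_cone_null[OF MH fr frb D_bd[OF i]])
      qed
      show "?S2 i \<in> null_sets mu"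
        by (rule coset_DU_null[OF mu cl clb A_bd[OF i]])
    qed auto
    moreover have "Xbd E \<subseteq> (\<Union>i\<in>{..<r}. ?S1 i \<union> ?S2 i)"
    proof (rule ccontr)
      assume "\<not> ?thesis"
      then obtain x where "x \<in> Xbd E" "x \<notin> (\<Union>i\<in>{..<r}. ?S1 i \<union> ?S2 i)" by blast
      then have x: "x \<in> Xbd E" "\<And>i. i < r \<Longrightarrow> x \<notin> ?S1 i \<and> x \<notin> ?S2 i" by blast+
      have "x \<in> Xsp"
        using x(1) frontier_of_subset_topspace[of Xtop E] by (auto simp: Xbd_def)
      then obtain g where g: "det g = 1" "x = coset g" by (rule XspE)
      \<comment> \<open>Off the exceptional set every count is constant near \<open>g\<close>; as
        there are finitely many \<open>i\<close>, a common neighbourhood exists, so membership in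
        \<open>E\<close> is constant near \<open>g\<close>.\<close>
      have "\<forall>i\<in>{..<r}. \<exists>V. open V \<and> g \<in> V \<and> (\<forall>v\<in>V. det v = 1 \<longrightarrow> ?cnt v i = ?cnt g i)"
        using x(2) g by (intro ballI orbit_hits_locally_constant D_HQ D_cpt A_bdd) auto
      from bchoice[OF this] obtain V where
        "\<forall>i\<in>{..<r}. open (V i) \<and> g \<in> V i \<and> (\<forall>v\<in>V i. det v = 1 \<longrightarrow> ?cnt v i = ?cnt g i)" ..
      then have V: "open (V i) \<and> g \<in> V i \<and> (\<forall>v\<in>V i. det v = 1 \<longrightarrow> ?cnt v i = ?cnt g i)" if "i < r" for i
        using that by simp
      have "coset g \<notin> Xbd E"
      proof (rule not_in_Xbd[OF g(1)])
        show "open (\<Inter>i\<in>{..<r}. V i)" using V by (intro open_INT) auto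
        show "g \<in> (\<Inter>i\<in>{..<r}. V i)" using V by auto
        fix v assume "v \<in> (\<Inter>i\<in>{..<r}. V i)" "det v = 1"
        then have "?cnt v i = ?cnt g i" if "i < r" for i
          using V[OF that] that by blast
        then show "coset v \<in> E \<longleftrightarrow> coset g \<in> E"
          by (simp add: E_iff[OF g(1)] E_iff[OF \<open>det v = 1\<close>])
      qed
      then show False using x(1) g(2) by simp
    qed
    moreover have "Xbd E \<in> sets mu"
      unfolding sets_mu Xbd_def by (intro closedin_Xborel closedin_frontier_of)
    ultimately have "Xbd E \<in> null_sets mu"
      using null_sets_subset by blast
    then show ?thesis by (simp add: measure_def null_setsD1)
  qed
  ultimately have lim: "((\<lambda>t. measure lam (phi e t ` E)) \<longlongrightarrow> measure mu E) at_top"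
    using lam by (simp add: admissible_def)
  have X: "phi e s x \<in> Xsp" if "x \<in> Xsp" for s and x :: "('k,'j) mat set"
    using that by (elim XspE) (simp add: phi_def det_mul)
  have phi_image: "phi e t ` E = {x \<in> Xsp. phi e (- t) x \<in> E}" for t
  proof -
    have "Phimat e (- s) ** Phimat e s = (mat 1 :: ('k,'j) mat)" for s
      using Phimat_inverse[of e "- s"] by simp
    then have inv: "phi e s (phi e (- s) x) = x" if "x \<in> Xsp" for s and x :: "('k,'j) mat set"
      using that by (elim XspE) (simp add: phi_def flip: matrix_mul_assoc)
    show ?thesis
    proof (intro equalityI subsetI)
      fix x assume "x \<in> phi e t ` E"
      then show "x \<in> {x \<in> Xsp. phi e (- t) x \<in> E}"
        using inv[of _ "- t"] X E_sub by auto
    next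
      fix x assume "x \<in> {x \<in> Xsp. phi e (- t) x \<in> E}"
      then show "x \<in> phi e t ` E"
        using inv[of x t] by (metis (mono_tags, lifting) imageI mem_Collect_eq)
    qed
  qed
  have "((\<lambda>L. measure lam (phi e (ln L / real CARD('k)) ` E)) \<longlongrightarrow> measure mu E) at_top"
  proof (rule filterlim_compose[OF lim])
    show "filterlim (\<lambda>L. ln L / real CARD('k)) at_top at_top"
      using filterlim_tendsto_pos_mult_at_top[OF tendsto_const _ ln_at_top, of "1 / real CARD('k)"] by simp
  qed
  \<comment> \<open>\<open>hits_L\<close> evaluates \<open>hits\<close> at
    \<open>phi e (- ln L / k) x\<close>, so the event at scale \<open>L\<close> is the set of
    \<open>x\<close> that this map sends into \<open>E\<close>, which is a forward translate of
    \<open>E\<close> by \<open>phi_image\<close>.\<close>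
  moreover have "phi e (ln L / real CARD('k)) ` E = {x \<in> Xsp. \<forall>i<r.
      finite (hits_L e F W L x (A i) (D i)) \<and> card (hits_L e F W L x (A i) (D i)) = N i}" for L
    unfolding phi_image unfolding hits_L_def E_def minus_divide_left using X by auto
  ultimately have 1: "((\<lambda>L. measure lam {x \<in> Xsp. \<forall>i<r.
      finite (hits_L e F W L x (A i) (D i)) \<and> card (hits_L e F W L x (A i) (D i)) = N i}) \<longlongrightarrow> measure mu E) at_top"
    by simp
  have "E = {coset g | g. g \<in> SLn \<and> (\<forall>i<r. finite (?cnt g i) \<and> card (?cnt g i) = N i)}"
  proof (intro equalityI subsetI)
    fix x assume "x \<in> E"
    moreover from this obtain g where "det g = 1" "x = coset g"
      using E_sub by (blast elim: XspE)
    ultimately show "x \<in> {coset g | g. g \<in> SLn \<and> (\<forall>i<r. finite (?cnt g i) \<and> card (?cnt g i) = N i)}"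
      using E_iff[of g] by (auto simp: SLn_def)
  qed (auto simp: SLn_def E_iff)
  with 1 show ?thesis
    unfolding E_def[symmetric] DU_def by simp
qed

end
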